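(* Let $F=\overline{\mathbb{F}}_\ell$ for any prime $\ell$, let $q$ be any prime power, let $n\ge 2$, let $G=\mathrm{GL}_n(\mathbb{F}_q)$, and let $U\le G$ be the subgroup of upper triangular matrices with all diagonal entries equal to $1$. For any nontrivial character $\psi$ of $\mathbb{F}_q$, $(G,U,\eta_\psi)$ is a multiplicity-free triple over $F$ (in other words, $(G,U)$ is an $\eta_\psi$-twisted Gelfand pair over $F$).
   Context: For a nontrivial character $\psi:\mathbb{F}_q\to F^\times$ of the additive group, $\eta_\psi:U\to F^\times$ is the character $\eta_\psi((x_{ij}))=\psi\left(\sum_{i=1}^{n-1}x_{i,i+1}\right)$. For a finite group $G$, subgroup $U$ and representation $\eta$ of $U$ over $F$, $(G,U,\eta)$ is a multiplicity-free triple over $F$ if $\dim_F\mathrm{Hom}_G(\pi,\mathrm{Ind}_U^G(\eta))\le 1$ for all irreducible representations $\pi$ of $G$ over $F$, where $\mathrm{Ind}_U^G(\eta)=F[G]\otimes_{F[U]}\eta$. *)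

theory Defs
  imports
    "HOL-Algebra.Algebraic_Closure_Type"
    "HOL-Algebra.Free_Abelian_Groups"
    "HOL-Algebra.Generated_Groups"
    "Berlekamp_Zassenhaus.Finite_Field"
    "Jordan_Normal_Form.VS_Connect"
begin

locale group_representation = G: group G + V: vectorspace F V
  for G :: "('g, 'x) monoid_scheme" and F :: "('f, 'y) ring_scheme"
    and V :: "('f, 'v, 'z) module_scheme" +
  fixes \<rho> :: "'g \<Rightarrow> 'v \<Rightarrow> 'v"
  assumes linear: "g \<in> carrier G \<Longrightarrow> \<rho> g \<in> module_hom F V V"
    and action_one: "v \<in> carrier V \<Longrightarrow> \<rho> \<one>\<^bsub>G\<^esub> v = v"
    and action_mult: "\<lbrakk>g \<in> carrier G; h \<in> carrier G; v \<in> carrier V\<rbrakk>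
      \<Longrightarrow> \<rho> (g \<otimes>\<^bsub>G\<^esub> h) v = \<rho> g (\<rho> h v)"

locale irreducible_representation = group_representation +
  assumes nonzero: "carrier V \<noteq> {\<zero>\<^bsub>V\<^esub>}"
    and invariant_subspace: "\<lbrakk>subspace F S V; \<And>g. g \<in> carrier G \<Longrightarrow> \<rho> g ` S \<subseteq> S\<rbrakk>
      \<Longrightarrow> S = {\<zero>\<^bsub>V\<^esub>} \<or> S = carrier V"

text \<open>The space of intertwiners. Maps are taken extensional on the carrier of the source, so that
  equality of functions is equality of maps. Here and below, the fields \<open>mult\<close> and \<open>one\<close> of a
  module record that only represents a vector space carry no meaning.\<close>

definition rep_Hom :: "('g, 'x) monoid_scheme \<Rightarrow> ('f, 'y) ring_scheme
    \<Rightarrow> ('f, 'v, 'z) module_scheme \<Rightarrow> ('g \<Rightarrow> 'v \<Rightarrow> 'v)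
    \<Rightarrow> ('f, 'w, 't) module_scheme \<Rightarrow> ('g \<Rightarrow> 'w \<Rightarrow> 'w) \<Rightarrow> ('f, 'v \<Rightarrow> 'w) module"
  where "rep_Hom G F V \<rho> W \<sigma> =
    \<lparr>carrier = {f \<in> module_hom F V W \<inter> extensional (carrier V).
        \<forall>g\<in>carrier G. \<forall>v\<in>carrier V. f (\<rho> g v) = \<sigma> g (f v)},
     monoid.mult = undefined,
     one = undefined,
     ring.zero = (\<lambda>v\<in>carrier V. \<zero>\<^bsub>W\<^esub>),
     add = (\<lambda>f h. \<lambda>v\<in>carrier V. f v \<oplus>\<^bsub>W\<^esub> h v),
     module.smult = (\<lambda>c f. \<lambda>v\<in>carrier V. c \<odot>\<^bsub>W\<^esub> f v)\<rparr>"

text \<open>The group algebra \<open>F[G]\<close> of a finite group: the function \<open>a\<close> stands for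
  \<open>\<Sum>\<^sub>g a(g) g\<close>, and multiplication is convolution.\<close>

definition group_algebra :: "('f, 'y) ring_scheme \<Rightarrow> ('g, 'x) monoid_scheme
    \<Rightarrow> ('f, 'g \<Rightarrow> 'f) module"
  where "group_algebra F G =
    \<lparr>carrier = carrier G \<rightarrow>\<^sub>E carrier F,
     monoid.mult = (\<lambda>a b. \<lambda>x\<in>carrier G. \<Oplus>\<^bsub>F\<^esub>y\<in>carrier G. a y \<otimes>\<^bsub>F\<^esub> b (inv\<^bsub>G\<^esub> y \<otimes>\<^bsub>G\<^esub> x)),
     one = (\<lambda>x\<in>carrier G. if x = \<one>\<^bsub>G\<^esub> then \<one>\<^bsub>F\<^esub> else \<zero>\<^bsub>F\<^esub>),
     ring.zero = (\<lambda>x\<in>carrier G. \<zero>\<^bsub>F\<^esub>),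
     add = (\<lambda>a b. \<lambda>x\<in>carrier G. a x \<oplus>\<^bsub>F\<^esub> b x),
     module.smult = (\<lambda>c a. \<lambda>x\<in>carrier G. c \<otimes>\<^bsub>F\<^esub> a x)\<rparr>"

definition group_algebra_of :: "('f, 'y) ring_scheme \<Rightarrow> ('g, 'x) monoid_scheme \<Rightarrow> 'g \<Rightarrow> 'g \<Rightarrow> 'f"
  where "group_algebra_of F G g = (\<lambda>x\<in>carrier G. if x = g then \<one>\<^bsub>F\<^esub> else \<zero>\<^bsub>F\<^esub>)"

definition group_algebra_incl :: "('f, 'y) ring_scheme \<Rightarrow> ('g, 'x) monoid_scheme \<Rightarrow> 'g set
    \<Rightarrow> ('g \<Rightarrow> 'f) \<Rightarrow> 'g \<Rightarrow> 'f"
  where "group_algebra_incl F G U b = (\<lambda>x\<in>carrier G. if x \<in> U then b x else \<zero>\<^bsub>F\<^esub>)"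

text \<open>The tensor product \<open>M \<otimes>\<^sub>A N\<close> of a right \<open>A\<close>-module \<open>M\<close> (action \<open>r m a\<close>) and a left
  \<open>A\<close>-module \<open>N\<close> (action \<open>l a n\<close>): the free abelian group on \<open>M \<times> N\<close> modulo the subgroup
  generated by the biadditivity and balancing relations. Its group operation is written
  multiplicatively, following \<open>free_Abelian_group\<close>.\<close>

definition tensor_relations :: "('a, 'p) ring_scheme \<Rightarrow> ('m, 'q) ring_scheme \<Rightarrow> ('m \<Rightarrow> 'a \<Rightarrow> 'm)
    \<Rightarrow> ('n, 's) ring_scheme \<Rightarrow> ('a \<Rightarrow> 'n \<Rightarrow> 'n) \<Rightarrow> ('m \<times> 'n \<Rightarrow>\<^sub>0 int) set"
  where "tensor_relations A M r N l =
    generate (free_Abelian_group (carrier M \<times> carrier N))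
      ({frag_of (x \<oplus>\<^bsub>M\<^esub> y, n) - frag_of (x, n) - frag_of (y, n) | x y n.
          x \<in> carrier M \<and> y \<in> carrier M \<and> n \<in> carrier N}
       \<union> {frag_of (m, x \<oplus>\<^bsub>N\<^esub> y) - frag_of (m, x) - frag_of (m, y) | m x y.
          m \<in> carrier M \<and> x \<in> carrier N \<and> y \<in> carrier N}
       \<union> {frag_of (r m a, n) - frag_of (m, l a n) | m a n.
          m \<in> carrier M \<and> a \<in> carrier A \<and> n \<in> carrier N})"

definition tensor_product :: "('a, 'p) ring_scheme \<Rightarrow> ('m, 'q) ring_scheme \<Rightarrow> ('m \<Rightarrow> 'a \<Rightarrow> 'm)
    \<Rightarrow> ('n, 's) ring_scheme \<Rightarrow> ('a \<Rightarrow> 'n \<Rightarrow> 'n) \<Rightarrow> ('m \<times> 'n \<Rightarrow>\<^sub>0 int) set monoid"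
  where "tensor_product A M r N l =
    free_Abelian_group (carrier M \<times> carrier N) Mod tensor_relations A M r N l"

text \<open>The endomorphism \<open>f \<otimes> id\<close> of \<open>M \<otimes>\<^sub>A N\<close> induced by an endomorphism \<open>f\<close> of the right
  module \<open>M\<close>; all members of the union are the same coset.\<close>

definition tensor_map_left :: "('a, 'p) ring_scheme \<Rightarrow> ('m, 'q) ring_scheme \<Rightarrow> ('m \<Rightarrow> 'a \<Rightarrow> 'm)
    \<Rightarrow> ('n, 's) ring_scheme \<Rightarrow> ('a \<Rightarrow> 'n \<Rightarrow> 'n) \<Rightarrow> ('m \<Rightarrow> 'm)
    \<Rightarrow> ('m \<times> 'n \<Rightarrow>\<^sub>0 int) set \<Rightarrow> ('m \<times> 'n \<Rightarrow>\<^sub>0 int) set"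
  where "tensor_map_left A M r N l f C =
    (\<Union>x\<in>C. tensor_relations A M r N l #>\<^bsub>free_Abelian_group (carrier M \<times> carrier N)\<^esub>
      frag_extend (\<lambda>(m, n). frag_of (f m, n)) x)"

text \<open>The induced representation \<open>F[G] \<otimes>\<^bsub>F[U]\<^esub> W\<close>, where \<open>F[U]\<close> acts on \<open>F[G]\<close> by right
  multiplication and on \<open>W\<close> by the linear extension of \<open>\<eta>\<close>. Scalars and \<open>G\<close> act by left
  multiplication on the factor \<open>F[G]\<close>.\<close>

definition right_mult_action :: "('f, 'y) ring_scheme \<Rightarrow> ('g, 'x) monoid_scheme \<Rightarrow> 'g set
    \<Rightarrow> ('g \<Rightarrow> 'f) \<Rightarrow> ('g \<Rightarrow> 'f) \<Rightarrow> 'g \<Rightarrow> 'f"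
  where "right_mult_action F G U a b = a \<otimes>\<^bsub>group_algebra F G\<^esub> group_algebra_incl F G U b"

definition linear_extension :: "'g set \<Rightarrow> ('f, 'w, 't) module_scheme \<Rightarrow> ('g \<Rightarrow> 'w \<Rightarrow> 'w)
    \<Rightarrow> ('g \<Rightarrow> 'f) \<Rightarrow> 'w \<Rightarrow> 'w"
  where "linear_extension U W \<eta> b w = (\<Oplus>\<^bsub>W\<^esub>u\<in>U. b u \<odot>\<^bsub>W\<^esub> \<eta> u w)"

definition Ind_tensor :: "('f, 'y) ring_scheme \<Rightarrow> ('g, 'x) monoid_scheme \<Rightarrow> 'g set
    \<Rightarrow> ('f, 'w, 't) module_scheme \<Rightarrow> ('g \<Rightarrow> 'w \<Rightarrow> 'w)
    \<Rightarrow> (('g \<Rightarrow> 'f) \<times> 'w \<Rightarrow>\<^sub>0 int) set monoid"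
  where "Ind_tensor F G U W \<eta> =
    tensor_product (group_algebra F (G\<lparr>carrier := U\<rparr>))
      (group_algebra F G) (right_mult_action F G U) W (linear_extension U W \<eta>)"

definition Ind_map :: "('f, 'y) ring_scheme \<Rightarrow> ('g, 'x) monoid_scheme \<Rightarrow> 'g set
    \<Rightarrow> ('f, 'w, 't) module_scheme \<Rightarrow> ('g \<Rightarrow> 'w \<Rightarrow> 'w) \<Rightarrow> (('g \<Rightarrow> 'f) \<Rightarrow> 'g \<Rightarrow> 'f)
    \<Rightarrow> (('g \<Rightarrow> 'f) \<times> 'w \<Rightarrow>\<^sub>0 int) set \<Rightarrow> (('g \<Rightarrow> 'f) \<times> 'w \<Rightarrow>\<^sub>0 int) set"
  where "Ind_map F G U W \<eta> =
    tensor_map_left (group_algebra F (G\<lparr>carrier := U\<rparr>))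
      (group_algebra F G) (right_mult_action F G U) W (linear_extension U W \<eta>)"

definition Ind_space :: "('f, 'y) ring_scheme \<Rightarrow> ('g, 'x) monoid_scheme \<Rightarrow> 'g set
    \<Rightarrow> ('f, 'w, 't) module_scheme \<Rightarrow> ('g \<Rightarrow> 'w \<Rightarrow> 'w)
    \<Rightarrow> ('f, (('g \<Rightarrow> 'f) \<times> 'w \<Rightarrow>\<^sub>0 int) set) module"
  where "Ind_space F G U W \<eta> =
    \<lparr>carrier = carrier (Ind_tensor F G U W \<eta>),
     monoid.mult = undefined,
     one = undefined,
     ring.zero = \<one>\<^bsub>Ind_tensor F G U W \<eta>\<^esub>,
     add = (\<otimes>\<^bsub>Ind_tensor F G U W \<eta>\<^esub>),
     module.smult = (\<lambda>c. Ind_map F G U W \<eta> (\<lambda>a. c \<odot>\<^bsub>group_algebra F G\<^esub> a))\<rparr>"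

definition Ind_action :: "('f, 'y) ring_scheme \<Rightarrow> ('g, 'x) monoid_scheme \<Rightarrow> 'g set
    \<Rightarrow> ('f, 'w, 't) module_scheme \<Rightarrow> ('g \<Rightarrow> 'w \<Rightarrow> 'w)
    \<Rightarrow> 'g \<Rightarrow> (('g \<Rightarrow> 'f) \<times> 'w \<Rightarrow>\<^sub>0 int) set \<Rightarrow> (('g \<Rightarrow> 'f) \<times> 'w \<Rightarrow>\<^sub>0 int) set"
  where "Ind_action F G U W \<eta> g =
    Ind_map F G U W \<eta> (\<lambda>a. group_algebra_of F G g \<otimes>\<^bsub>group_algebra F G\<^esub> a)"

text \<open>The type argument only fixes the type in which the irreducible representations have their
  carriers. Since \<open>vectorspace.dim\<close> is a natural number that is meaningful for finite-dimensional
  spaces only, finite dimension is part of the bound.\<close>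

definition multiplicity_free_triple :: "'v itself \<Rightarrow> ('f, 'y) ring_scheme
    \<Rightarrow> ('g, 'x) monoid_scheme \<Rightarrow> 'g set \<Rightarrow> ('f, 'w, 't) module_scheme \<Rightarrow> ('g \<Rightarrow> 'w \<Rightarrow> 'w) \<Rightarrow> bool"
  where "multiplicity_free_triple (_ :: 'v itself) F G U W \<eta> \<longleftrightarrow>
    group G \<and> finite (carrier G) \<and> subgroup U G \<and> group_representation (G\<lparr>carrier := U\<rparr>) F W \<eta> \<and>
    (\<forall>(V :: ('f, 'v) module) \<pi>. irreducible_representation G F V \<pi> \<longrightarrow>
      (let H = rep_Hom G F V \<pi> (Ind_space F G U W \<eta>) (Ind_action F G U W \<eta>)
       in vectorspace.fin_dim F H \<and> vectorspace.dim F H \<le> 1))"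

text \<open>A character, viewed as a representation on the one-dimensional space \<open>F\<close>.\<close>

definition line :: "('f, 'y) ring_scheme \<Rightarrow> ('f, 'f) module"
  where "line F = \<lparr>carrier = carrier F, monoid.mult = monoid.mult F,
    one = \<one>\<^bsub>F\<^esub>, ring.zero = \<zero>\<^bsub>F\<^esub>, add = add F, module.smult = monoid.mult F\<rparr>"

definition character_action :: "('f, 'y) ring_scheme \<Rightarrow> ('g \<Rightarrow> 'f) \<Rightarrow> 'g \<Rightarrow> 'f \<Rightarrow> 'f"
  where "character_action F \<chi> g x = \<chi> g \<otimes>\<^bsub>F\<^esub> x"

definition GL :: "nat \<Rightarrow> 'k :: field mat monoid"
  where "GL n = units_of (ring_mat TYPE('k) n ())"

definition unitriangular :: "nat \<Rightarrow> 'k :: field mat set"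
  where "unitriangular n = {A \<in> carrier (GL n). upper_triangular A \<and> (\<forall>i<n. A $$ (i, i) = 1)}"

text \<open>Matrix indices start at \<open>0\<close>, so the superdiagonal entries are \<open>A\<^bsub>i,i+1\<^esub>\<close> for \<open>i < n - 1\<close>.\<close>

definition eta :: "nat \<Rightarrow> ('k :: field \<Rightarrow> 'f) \<Rightarrow> 'k mat \<Rightarrow> 'f"
  where "eta n \<psi> A = \<psi> (\<Sum>i<n - 1. A $$ (i, i + 1))"

definition nontrivial_character :: "('f, 'y) ring_scheme \<Rightarrow> ('k :: field \<Rightarrow> 'f) \<Rightarrow> bool"
  where "nontrivial_character F \<psi> \<longleftrightarrow>
    \<psi> \<in> hom (add_monoid (class_ring :: 'k ring)) (units_of F) \<and> (\<exists>x. \<psi> x \<noteq> \<one>\<^bsub>F\<^esub>)"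

text \<open>\<open>\<F>\<^sub>\<ell>\<close> is \<open>'l mod_ring\<close> for a type \<open>'l\<close> of prime cardinality \<open>\<ell>\<close>.\<close>

abbreviation Fl_bar :: "'l :: prime_card itself \<Rightarrow> 'l mod_ring alg_closure ring"
  where "Fl_bar _ \<equiv> class_ring"

end

theory Submission
  imports Defs "HOL-Algebra.Sylow"
begin

text \<open>Write \<open>\<theta>\<close> for the character of \<open>U\<close>. A nontrivial \<open>\<psi>\<close> exists only if \<open>\<ell>\<close> does not divide \<open>q\<close>, so
  \<open>|U|\<close> is invertible in \<open>F\<close> and the idempotent \<open>e = |U|\<^sup>-\<^sup>1 \<Sum> \<theta>(u\<^sup>-\<^sup>1) u\<close> is available. The map
  \<open>a \<otimes> c \<mapsto> c a e\<close> embeds the induced representation into \<open>F[G]\<close>; evaluating at the identity turns a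
  homomorphism \<open>\<pi> \<rightarrow> Ind\<close> into a functional \<open>l\<close> on \<open>\<pi>\<close> with \<open>l(u v) = \<theta>(u) l(v)\<close>, which determines it
  and is itself determined by its restriction to \<open>e \<pi>\<close>. The algebra \<open>e F[G] e\<close> is commutative by
  Gelfand's trick: by the Bruhat decomposition the reflection in the antidiagonal fixes every double
  coset of \<open>U\<close> that supports an equivariant function. As \<open>e F[G] e\<close> acts on \<open>e \<pi>\<close>
  irreducibly and \<open>F\<close> is algebraically closed, \<open>e \<pi>\<close> is at most one-dimensional.\<close>

text \<open>The characteristic of \<open>F\<close> may divide the order of \<open>G\<close>, and
  \<open>V\<close> is not assumed finite-dimensional, so neither complete reducibility nor
  finite-dimensional linear algebra inside \<open>V\<close> is at hand. A fixed nonzero functional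
  \<open>l\<close> replaces both: by irreducibility a vector \<open>v\<close> is determined by the
  scalars \<open>l (\<rho> g v)\<close>, so identities in \<open>V\<close> become identities between
  sums over \<open>G\<close>, and linear dependence is only sought among functions on the finite set
  \<open>G\<close>. The reflection is \<open>A \<mapsto> J A^T J\<close> with \<open>J\<close> the
  reversal permutation matrix. Like the transpose it reverses products, but it maps \<open>U\<close>
  to itself and permutes the superdiagonal, hence fixes \<open>\<theta>\<close>. The monomial
  matrices that support an equivariant function turn out to consist of scalar blocks placed along
  the antidiagonal, and these are fixed by the reflection.\<close>

section \<open>Hecke functions\<close>

text \<open>Linear dependence of \<open>card S + 1\<close> vectors with \<open>card S\<close>
  coordinates. It is packaged as a polynomial because \<open>F k\<close> will be a convolution
  power, which makes \<open>p\<close> an annihilating polynomial.\<close>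

lemma exists_poly_combination_zero:
  fixes F :: "nat \<Rightarrow> 'g \<Rightarrow> 'f :: field"
  assumes "finite S"
  shows "\<exists>p :: 'f poly. p \<noteq> 0 \<and> (\<forall>x\<in>S. (\<Sum>k\<le>degree p. coeff p k * F k x) = 0)"
proof -
  obtain g where g: "bij_betw g {0..<card S} S"
    using ex_bij_betw_nat_finite[OF assms] by blast
  let ?m = "card S"
  \<comment> \<open>The extra zero row squares the system of \<open>card S\<close> equations in
    \<open>card S + 1\<close> unknowns, so a vanishing determinant yields a kernel vector.\<close>
  define M where "M = mat\<^sub>r (Suc ?m) (Suc ?m)
    (\<lambda>i. if i = ?m then 0\<^sub>v (Suc ?m) else vec (Suc ?m) (\<lambda>k. F k (g i)))"
  have M: "M \<in> carrier_mat (Suc ?m) (Suc ?m)" by (simp add: M_def)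
  have "det M = 0"
    unfolding M_def by (rule det_row_0) auto
  then obtain v where v: "v \<in> carrier_vec (Suc ?m)" "v \<noteq> 0\<^sub>v (Suc ?m)"
    and Mv: "M *\<^sub>v v = 0\<^sub>v (Suc ?m)"
    using det_0_iff_vec_prod_zero_field[OF M] by blast
  define p where "p = (\<Sum>k\<le>?m. monom (v $ k) k)"
  have c: "coeff p k = (if k \<le> ?m then v $ k else 0)" for k
    by (simp add: p_def coeff_sum)
  have deg: "degree p \<le> ?m"
    by (rule degree_le) (simp add: c)
  have "p \<noteq> 0"
  proof
    assume "p = 0"
    then have "v $ k = 0" if "k \<le> ?m" for k using c[of k] that by simp
    then have "v = 0\<^sub>v (Suc ?m)" using v(1) by (intro eq_vecI) auto
    with v(2) show False by simp
  qed
  moreover have "(\<Sum>k\<le>degree p. coeff p k * F k x) = 0" if "x \<in> S" for x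
  proof -
    have "x \<in> g ` {0..<?m}"
      using that bij_betw_imp_surj_on[OF g] by simp
    then obtain i where i: "i < ?m" "x = g i" by auto
    have "(\<Sum>k\<le>degree p. coeff p k * F k x) = (\<Sum>k\<le>?m. coeff p k * F k x)"
      by (rule sum.mono_neutral_left) (use deg in \<open>auto simp: coeff_eq_0\<close>)
    also have "\<dots> = (\<Sum>k\<in>{0..<Suc ?m}. F k (g i) * v $ k)"
      by (rule sum.cong) (auto simp: c i)
    also have "\<dots> = (M *\<^sub>v v) $ i"
      using i v(1) by (simp add: M_def scalar_prod_def)
    also have "\<dots> = 0" using Mv i by simp
    finally show ?thesis .
  qed
  ultimately show ?thesis by blast
qed

lemma alg_closed_linear_factor:
  fixes p :: "'f :: alg_closed_field poly"
  assumes "degree p > 0"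
  shows "\<exists>c q. p = [:- c, 1:] * q \<and> q \<noteq> 0 \<and> degree p = Suc (degree q)"
proof -
  obtain c where "poly p c = 0"
    using alg_closed_imp_poly_has_root[OF assms] by blast
  then obtain q where q: "p = [:- c, 1:] * q"
    by (auto simp: poly_eq_0_iff_dvd elim: dvdE)
  have "q \<noteq> 0" using q assms by (metis degree_0 mult_zero_right less_irrefl)
  moreover have "degree p = degree [:- c, 1:] + degree q"
    using degree_mult_eq[of "[:- c, 1:]" q] \<open>q \<noteq> 0\<close> unfolding q by fastforce
  ultimately show ?thesis using q by auto
qed

text \<open>\<open>card_U\<close> makes averaging over \<open>U\<close> possible even when the
  characteristic of \<open>'f\<close> divides the order of \<open>G\<close>.\<close>

locale multiplicative_character = group G for G :: "('g, 'x) monoid_scheme" (structure) +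
  fixes U :: "'g set" and \<theta> :: "'g \<Rightarrow> 'f :: field"
  assumes finite_G: "finite (carrier G)"
    and subgroup_U: "subgroup U G"
    and theta_mult: "\<lbrakk>u \<in> U; w \<in> U\<rbrakk> \<Longrightarrow> \<theta> (u \<otimes> w) = \<theta> u * \<theta> w"
    and theta_one: "\<theta> \<one> = 1"
    and card_U: "of_nat (card U) \<noteq> (0 :: 'f)"
begin

lemma U_sub: "u \<in> U \<Longrightarrow> u \<in> carrier G"
  using subgroup.mem_carrier[OF subgroup_U] .

lemma U_inv: "u \<in> U \<Longrightarrow> inv u \<in> U"
  using subgroup.m_inv_closed[OF subgroup_U] .

lemma U_mult: "u \<in> U \<Longrightarrow> w \<in> U \<Longrightarrow> u \<otimes> w \<in> U"
  using subgroup.m_closed[OF subgroup_U] .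

lemma U_one: "\<one> \<in> U"
  using subgroup.one_closed[OF subgroup_U] .

lemma finite_U: "finite U"
  using finite_G finite_subset subgroup.subset[OF subgroup_U] by blast

lemma theta_inv: "u \<in> U \<Longrightarrow> \<theta> (inv u) * \<theta> u = 1" "u \<in> U \<Longrightarrow> \<theta> u * \<theta> (inv u) = 1"
  using theta_mult[of "inv u" u] theta_mult[of u "inv u"] U_inv U_sub theta_one by auto

lemma theta_inv_eq: "u \<in> U \<Longrightarrow> \<theta> (inv u) = inverse (\<theta> u)"
  using theta_inv(1)[of u] by (metis inverse_unique mult.commute)

lemma mult_in_U_iff: "u \<in> U \<Longrightarrow> x \<in> carrier G \<Longrightarrow> u \<otimes> x \<in> U \<longleftrightarrow> x \<in> U"
  "u \<in> U \<Longrightarrow> x \<in> carrier G \<Longrightarrow> x \<otimes> u \<in> U \<longleftrightarrow> x \<in> U"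
proof -
  assume u: "u \<in> U" and x: "x \<in> carrier G"
  have "x = inv u \<otimes> (u \<otimes> x)" "x = (x \<otimes> u) \<otimes> inv u"
    using u x U_sub by (auto simp: m_assoc[symmetric]) (simp add: m_assoc)
  then show "u \<otimes> x \<in> U \<longleftrightarrow> x \<in> U" "x \<otimes> u \<in> U \<longleftrightarrow> x \<in> U"
    using U_mult U_inv u by metis+
qed

lemma sum_left_translate:
  "h \<in> carrier G \<Longrightarrow> (\<Sum>x\<in>carrier G. (F (h \<otimes> x) :: 'f)) = (\<Sum>x\<in>carrier G. F x)"
  by (rule sum.reindex_bij_witness[of _ "\<lambda>x. inv h \<otimes> x" "\<lambda>x. h \<otimes> x"])
     (auto simp: m_assoc[symmetric])

text \<open>The product of \<open>group_algebra\<close> without the restriction to the carrier;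
  identities between such functions are therefore stated pointwise on
  \<open>carrier G\<close>.\<close>

definition conv :: "('g \<Rightarrow> 'f) \<Rightarrow> ('g \<Rightarrow> 'f) \<Rightarrow> 'g \<Rightarrow> 'f"
  where "conv a b x = (\<Sum>y\<in>carrier G. a y * b (inv y \<otimes> x))"

text \<open>These are the functions in \<open>e F[G] e\<close>, for the idempotent \<open>e\<close> called \<open>idem\<close> below.\<close>

definition hecke :: "('g \<Rightarrow> 'f) \<Rightarrow> bool"
  where "hecke f \<longleftrightarrow> (\<forall>x\<in>carrier G. \<forall>u\<in>U. f (u \<otimes> x) = \<theta> (inv u) * f x \<and> f (x \<otimes> u) = \<theta> (inv u) * f x)"

lemma hecke_left:
    "hecke f \<Longrightarrow> u \<in> U \<Longrightarrow> x \<in> carrier G \<Longrightarrow> f (u \<otimes> x) = \<theta> (inv u) * f x"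
  and hecke_right:
    "hecke f \<Longrightarrow> u \<in> U \<Longrightarrow> x \<in> carrier G \<Longrightarrow> f (x \<otimes> u) = \<theta> (inv u) * f x"
  by (simp_all add: hecke_def)

text \<open>The weights \<open>\<theta> (inv x)\<close> make \<open>act idem\<close> below the
  projection onto the vectors on which \<open>U\<close> acts through \<open>\<theta>\<close>. They
  also explain the inverses in \<open>hecke\<close>.\<close>

definition idem :: "'g \<Rightarrow> 'f"
  where "idem x = (if x \<in> U then \<theta> (inv x) / of_nat (card U) else 0)"

lemma idem_left: "u \<in> U \<Longrightarrow> x \<in> carrier G \<Longrightarrow> idem (u \<otimes> x) = \<theta> (inv u) * idem x"
  using mult_in_U_iff(1)[of u x] U_sub U_inv
  by (auto simp: idem_def inv_mult_group theta_mult)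

lemma idem_right: "u \<in> U \<Longrightarrow> x \<in> carrier G \<Longrightarrow> idem (x \<otimes> u) = \<theta> (inv u) * idem x"
  using mult_in_U_iff(2)[of u x] U_sub U_inv
  by (auto simp: idem_def inv_mult_group theta_mult)

lemma hecke_idem: "hecke idem"
  by (simp add: hecke_def idem_left idem_right)

lemma conv_left:
  assumes "\<And>u x. u \<in> U \<Longrightarrow> x \<in> carrier G \<Longrightarrow> a (u \<otimes> x) = \<theta> (inv u) * a x"
    and "u \<in> U" "x \<in> carrier G"
  shows "conv a b (u \<otimes> x) = \<theta> (inv u) * conv a b x"
proof -
  have "conv a b (u \<otimes> x) = (\<Sum>y\<in>carrier G. a (u \<otimes> y) * b (inv (u \<otimes> y) \<otimes> (u \<otimes> x)))"
    unfolding conv_def using U_sub[OF assms(2)]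
    by (subst sum_left_translate[symmetric, of u]) auto
  also have "\<dots> = (\<Sum>y\<in>carrier G. \<theta> (inv u) * (a y * b (inv y \<otimes> x)))"
  proof (rule sum.cong)
    fix y assume y: "y \<in> carrier G"
    have "inv (u \<otimes> y) \<otimes> (u \<otimes> x) = inv y \<otimes> x"
      using y assms(2,3) U_sub by (simp add: inv_mult_group m_assoc) (simp add: m_assoc[symmetric])
    then show "a (u \<otimes> y) * b (inv (u \<otimes> y) \<otimes> (u \<otimes> x)) = \<theta> (inv u) * (a y * b (inv y \<otimes> x))"
      using assms(1,2) y by (simp add: mult_ac)
  qed simp
  finally show ?thesis by (simp add: conv_def sum_distrib_left)
qed

lemma conv_right:
  assumes "\<And>u x. u \<in> U \<Longrightarrow> x \<in> carrier G \<Longrightarrow> b (x \<otimes> u) = \<theta> (inv u) * b x"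
    and "u \<in> U" "x \<in> carrier G"
  shows "conv a b (x \<otimes> u) = \<theta> (inv u) * conv a b x"
  unfolding conv_def sum_distrib_left
  by (rule sum.cong) (use assms U_sub in \<open>auto simp: m_assoc[symmetric] mult_ac\<close>)

lemma hecke_conv: "hecke a \<Longrightarrow> hecke b \<Longrightarrow> hecke (conv a b)"
  unfolding hecke_def by (auto intro!: conv_left conv_right)

lemma hecke_sandwich: "hecke (conv idem (conv a idem))"
  unfolding hecke_def by (auto intro!: conv_left conv_right idem_left idem_right)

lemma hecke_sum: "(\<And>k. k \<in> K \<Longrightarrow> hecke (F k)) \<Longrightarrow> hecke (\<lambda>x. \<Sum>k\<in>K. c k * F k x)"
  unfolding hecke_def by (auto simp: sum_distrib_left mult_ac intro!: sum.cong)

lemma sum_idem: "(\<Sum>x\<in>carrier G. idem x * F x) = (\<Sum>u\<in>U. \<theta> (inv u) * F u) / of_nat (card U)"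
proof -
  have "(\<Sum>x\<in>carrier G. idem x * F x) = (\<Sum>u\<in>U. idem u * F u)"
    by (rule sum.mono_neutral_right) (use finite_G U_sub in \<open>auto simp: idem_def\<close>)
  then show ?thesis by (simp add: idem_def sum_divide_distrib)
qed

lemma conv_idem:
  assumes "hecke f" "x \<in> carrier G"
  shows "conv idem f x = f x"
proof -
  have "f (inv u \<otimes> x) = \<theta> u * f x" if "u \<in> U" for u
    using assms that U_inv[OF that] U_sub unfolding hecke_def by fastforce
  then have "(\<Sum>u\<in>U. \<theta> (inv u) * f (inv u \<otimes> x)) = (\<Sum>u\<in>U. f x)"
    by (intro sum.cong refl) (simp add: theta_inv mult.assoc[symmetric])
  then show ?thesis
    unfolding conv_def sum_idem using card_U by simp
qed

text \<open>Gelfand's trick: \<open>conv f h\<close> is itself a Hecke function, so it may be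
  evaluated at \<open>t x\<close> instead of \<open>x\<close>. Since \<open>t\<close> reverses
  products, moving it through the sum interchanges the two factors.\<close>

lemma conv_commute_if_anti_involution:
  assumes t_in: "\<And>x. x \<in> carrier G \<Longrightarrow> t x \<in> carrier G"
    and t_t: "\<And>x. x \<in> carrier G \<Longrightarrow> t (t x) = x"
    and t_mult: "\<And>x y. x \<in> carrier G \<Longrightarrow> y \<in> carrier G \<Longrightarrow> t (x \<otimes> y) = t y \<otimes> t x"
    and hecke_t: "\<And>f x. hecke f \<Longrightarrow> x \<in> carrier G \<Longrightarrow> f (t x) = f x"
    and f: "hecke f" and h: "hecke h" and x: "x \<in> carrier G"
  shows "conv f h x = conv h f x"
proof -
  have t_inv: "inv (t y) = t (inv y)" if y: "y \<in> carrier G" for y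
  proof -
    have "t \<one> \<otimes> t \<one> = t \<one>" using t_mult[OF one_closed one_closed] by simp
    then have "t \<one> = \<one>" using t_in[OF one_closed] by simp
    then have "t (inv y) \<otimes> t y = \<one>" using t_mult[OF y inv_closed[OF y]] y by simp
    then show ?thesis using t_in y by (intro inv_equality) auto
  qed
  have cancel: "x \<otimes> (inv x \<otimes> z) = z" if "z \<in> carrier G" for z
    using x that by (simp add: m_assoc[symmetric])
  have "conv f h x = conv f h (t x)"
    using hecke_t[OF hecke_conv[OF f h] x] by simp
  also have "\<dots> = (\<Sum>y\<in>carrier G. f (t y) * h (inv (t y) \<otimes> t x))"
    unfolding conv_def by (rule sum.reindex_bij_witness[of _ t t]) (auto simp: t_in t_t)
  also have "\<dots> = (\<Sum>y\<in>carrier G. f y * h (x \<otimes> inv y))"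
  proof (rule sum.cong)
    fix y assume y: "y \<in> carrier G"
    have "inv (t y) \<otimes> t x = t (x \<otimes> inv y)"
      using t_mult[OF x inv_closed[OF y]] t_inv[OF y] by simp
    then show "f (t y) * h (inv (t y) \<otimes> t x) = f y * h (x \<otimes> inv y)"
      using hecke_t[OF f y] hecke_t[OF h, of "x \<otimes> inv y"] x y by simp
  qed simp
  \<comment> \<open>Substitution \<open>z = x \<otimes> inv y\<close>, so that
    \<open>y = inv z \<otimes> x\<close>.\<close>
  also have "\<dots> = (\<Sum>z\<in>carrier G. h z * f (inv z \<otimes> x))"
    by (rule sum.reindex_bij_witness[of _ "\<lambda>z. inv z \<otimes> x" "\<lambda>y. x \<otimes> inv y"])
       (use x cancel in \<open>auto simp: inv_mult_group m_assoc mult.commute\<close>)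
  finally show ?thesis by (simp add: conv_def)
qed

end

section \<open>Whittaker functionals\<close>

locale irreducible_with_character = multiplicative_character G U \<theta>
  for G :: "('g, 'x) monoid_scheme" (structure) and U and \<theta> :: "'g \<Rightarrow> 'f :: alg_closed_field" +
  fixes V :: "('f, 'v) module" and \<rho> :: "'g \<Rightarrow> 'v \<Rightarrow> 'v"
  assumes irr: "irreducible_representation G class_ring V \<rho>"
begin

interpretation irreducible_representation G class_ring V \<rho> by (rule irr)

text \<open>The elements of \<open>Hom_U(V, \<theta>)\<close>, the other side of Frobenius
  reciprocity. Values outside \<open>carrier V\<close> are left arbitrary.\<close>

definition whittaker_functional :: "('v \<Rightarrow> 'f) \<Rightarrow> bool"
  where "whittaker_functional l \<longleftrightarrow>
    (\<forall>v\<in>carrier V. \<forall>w\<in>carrier V. l (v \<oplus>\<^bsub>V\<^esub> w) = l v + l w) \<and>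
    (\<forall>c. \<forall>v\<in>carrier V. l (c \<odot>\<^bsub>V\<^esub> v) = c * l v) \<and>
    (\<forall>u\<in>U. \<forall>v\<in>carrier V. l (\<rho> u v) = \<theta> u * l v)"

lemma wf_add: "whittaker_functional l \<Longrightarrow> v \<in> carrier V \<Longrightarrow> w \<in> carrier V \<Longrightarrow> l (v \<oplus>\<^bsub>V\<^esub> w) = l v + l w"
  and wf_smult: "whittaker_functional l \<Longrightarrow> v \<in> carrier V \<Longrightarrow> l (c \<odot>\<^bsub>V\<^esub> v) = c * l v"
  and wf_equiv: "whittaker_functional l \<Longrightarrow> v \<in> carrier V \<Longrightarrow> u \<in> U \<Longrightarrow> l (\<rho> u v) = \<theta> u * l v"
  by (auto simp: whittaker_functional_def)

lemma smult_in [simp]: "v \<in> carrier V \<Longrightarrow> c \<odot>\<^bsub>V\<^esub> v \<in> carrier V"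
  using V.smult_closed[of c v] by simp

lemma rho_in [simp]: "g \<in> carrier G \<Longrightarrow> v \<in> carrier V \<Longrightarrow> \<rho> g v \<in> carrier V"
  using linear[of g] by (auto simp: module_hom_def)

lemma rho_add: "g \<in> carrier G \<Longrightarrow> v \<in> carrier V \<Longrightarrow> w \<in> carrier V \<Longrightarrow> \<rho> g (v \<oplus>\<^bsub>V\<^esub> w) = \<rho> g v \<oplus>\<^bsub>V\<^esub> \<rho> g w"
  using linear[of g] by (auto simp: module_hom_def)

lemma rho_smult: "g \<in> carrier G \<Longrightarrow> v \<in> carrier V \<Longrightarrow> \<rho> g (c \<odot>\<^bsub>V\<^esub> v) = c \<odot>\<^bsub>V\<^esub> \<rho> g v"
  using linear[of g] by (auto simp: module_hom_def)

lemma wf_zero: "whittaker_functional l \<Longrightarrow> l \<zero>\<^bsub>V\<^esub> = 0"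
  using wf_smult[of l "\<zero>\<^bsub>V\<^esub>" 0] by simp

definition act :: "('g \<Rightarrow> 'f) \<Rightarrow> 'v \<Rightarrow> 'v"
  where "act a v = (\<Oplus>\<^bsub>V\<^esub>g\<in>carrier G. a g \<odot>\<^bsub>V\<^esub> \<rho> g v)"

lemma act_in [simp]: "v \<in> carrier V \<Longrightarrow> act a v \<in> carrier V"
  unfolding act_def by (rule V.finsum_closed) simp

lemma rho_finsum:
  assumes l: "whittaker_functional l" and g: "g \<in> carrier G" and S: "finite S" "F \<in> S \<rightarrow> carrier V"
  shows "l (\<rho> g (finsum V F S)) = (\<Sum>x\<in>S. l (\<rho> g (F x)))"
  using S
proof (induction S rule: finite_induct)
  case empty
  have "\<rho> g \<zero>\<^bsub>V\<^esub> = \<zero>\<^bsub>V\<^esub>"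
    using rho_smult[OF g, of "\<zero>\<^bsub>V\<^esub>" 0] g V.smult_l_null[of "\<zero>\<^bsub>V\<^esub>"] V.smult_l_null[of "\<rho> g \<zero>\<^bsub>V\<^esub>"] by simp
  then show ?case using wf_zero[OF l] by simp
next
  case (insert x S)
  then show ?case using g by (simp add: rho_add wf_add[OF l] Pi_iff V.finsum_insert V.finsum_closed)
qed

lemma l_act:
  assumes l: "whittaker_functional l" and "g \<in> carrier G" "v \<in> carrier V"
  shows "l (\<rho> g (act a v)) = (\<Sum>h\<in>carrier G. a h * l (\<rho> (g \<otimes> h) v))"
proof -
  have "l (\<rho> g (act a v)) = (\<Sum>h\<in>carrier G. l (\<rho> g (a h \<odot>\<^bsub>V\<^esub> \<rho> h v)))"
    unfolding act_def using assms by (intro rho_finsum[OF l]) (auto simp: finite_G)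
  also have "\<dots> = (\<Sum>h\<in>carrier G. a h * l (\<rho> (g \<otimes> h) v))"
    using assms by (intro sum.cong refl) (simp add: rho_smult wf_smult[OF l] action_mult)
  finally show ?thesis .
qed

lemma eq_if_diff_zero:
  assumes xy: "x \<in> carrier V" "y \<in> carrier V" and eq: "x \<oplus>\<^bsub>V\<^esub> (- 1) \<odot>\<^bsub>V\<^esub> y = \<zero>\<^bsub>V\<^esub>"
  shows "x = y"
proof -
  have "y \<oplus>\<^bsub>V\<^esub> (- 1) \<odot>\<^bsub>V\<^esub> y = \<zero>\<^bsub>V\<^esub>"
    using V.smult_l_distr[of 1 "- 1" y] V.smult_one[OF xy(2)] V.smult_l_null[OF xy(2)] xy(2) by simp
  then have "y \<oplus>\<^bsub>V\<^esub> (- 1) \<odot>\<^bsub>V\<^esub> y = x \<oplus>\<^bsub>V\<^esub> (- 1) \<odot>\<^bsub>V\<^esub> y"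
    using eq by (rule trans[OF _ sym])
  then show ?thesis
    using V.add.right_cancel[OF smult_in[OF xy(2)] xy(2,1)] by simp
qed

context
  fixes l v0
  assumes l: "whittaker_functional l" and v0: "v0 \<in> carrier V" "l v0 \<noteq> 0"
begin

lemmas l_rho_act = l_act[OF l]
lemmas l_add = wf_add[OF l]
lemmas l_smult = wf_smult[OF l]

text \<open>The vectors all of whose translates are killed by \<open>l\<close> form an invariant
  subspace that misses \<open>v0\<close>, so it is zero. This gives \<open>vector_eqI\<close>, by
  which equalities in \<open>V\<close> are checked on scalars.\<close>

lemma kernel_zero:
  assumes "v \<in> carrier V" "\<And>g. g \<in> carrier G \<Longrightarrow> l (\<rho> g v) = 0"
  shows "v = \<zero>\<^bsub>V\<^esub>"
proof -
  let ?K = "{v \<in> carrier V. \<forall>g\<in>carrier G. l (\<rho> g v) = 0}"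
  have "l (\<rho> g \<zero>\<^bsub>V\<^esub>) = 0" if "g \<in> carrier G" for g
    using rho_finsum[OF l that, of "{}" "\<lambda>_. \<zero>\<^bsub>V\<^esub>"] by simp
  then have z: "\<zero>\<^bsub>V\<^esub> \<in> ?K" by simp
  have "subspace class_ring ?K V"
    using V.vectorspace_axioms V.module_axioms z
    by (intro subspace.intro submodule.intro) (auto simp: rho_add rho_smult l_add l_smult)
  moreover have "\<rho> g ` ?K \<subseteq> ?K" if "g \<in> carrier G" for g
    using that by (auto simp: action_mult[symmetric])
  ultimately have "?K = {\<zero>\<^bsub>V\<^esub>} \<or> ?K = carrier V"
    by (rule invariant_subspace)
  moreover have "v0 \<notin> ?K" using v0(2) action_one[OF v0(1)] by (auto intro!: bexI[of _ \<one>])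
  ultimately have "?K = {\<zero>\<^bsub>V\<^esub>}" using v0 by blast
  then show ?thesis using assms by blast
qed

lemma vector_eqI:
  assumes "v \<in> carrier V" "w \<in> carrier V" "\<And>g. g \<in> carrier G \<Longrightarrow> l (\<rho> g v) = l (\<rho> g w)"
  shows "v = w"
proof (rule eq_if_diff_zero)
  show "v \<oplus>\<^bsub>V\<^esub> (- 1) \<odot>\<^bsub>V\<^esub> w = \<zero>\<^bsub>V\<^esub>"
  proof (rule kernel_zero)
    fix g assume "g \<in> carrier G"
    then show "l (\<rho> g (v \<oplus>\<^bsub>V\<^esub> (- 1) \<odot>\<^bsub>V\<^esub> w)) = 0"
      using assms(3)[of g] assms(1,2) by (simp add: rho_add rho_smult l_add l_smult)
  qed (use assms in simp)
qed (use assms in simp_all)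

lemma act_conv: "v \<in> carrier V \<Longrightarrow> act a (act b v) = act (conv a b) v"
proof (rule vector_eqI)
  fix g assume v: "v \<in> carrier V" and g: "g \<in> carrier G"
  have "l (\<rho> g (act a (act b v))) = (\<Sum>h\<in>carrier G. \<Sum>k\<in>carrier G. a h * b k * l (\<rho> (g \<otimes> (h \<otimes> k)) v))"
    using v g l by (simp add: l_rho_act sum_distrib_left m_assoc mult.assoc)
  also have "\<dots> = (\<Sum>h\<in>carrier G. \<Sum>x\<in>carrier G. a h * b (inv h \<otimes> x) * l (\<rho> (g \<otimes> x) v))"
  proof (rule sum.cong)
    fix h assume h: "h \<in> carrier G"
    show "(\<Sum>k\<in>carrier G. a h * b k * l (\<rho> (g \<otimes> (h \<otimes> k)) v)) =
      (\<Sum>x\<in>carrier G. a h * b (inv h \<otimes> x) * l (\<rho> (g \<otimes> x) v))"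
      using sum_left_translate[OF h, of "\<lambda>x. a h * b (inv h \<otimes> x) * l (\<rho> (g \<otimes> x) v)"] h
      by (simp add: m_assoc[symmetric])
  qed simp
  also have "\<dots> = l (\<rho> g (act (conv a b) v))"
    using v g l by (subst sum.swap) (simp add: l_rho_act conv_def sum_distrib_right)
  finally show "l (\<rho> g (act a (act b v))) = l (\<rho> g (act (conv a b) v))" .
qed simp_all

lemma act_smult:
  assumes v: "v \<in> carrier V"
  shows "act a (c \<odot>\<^bsub>V\<^esub> v) = c \<odot>\<^bsub>V\<^esub> act a v"
proof (rule vector_eqI)
  fix g assume g: "g \<in> carrier G"
  have "l (\<rho> g (act a (c \<odot>\<^bsub>V\<^esub> v))) = (\<Sum>h\<in>carrier G. a h * (c * l (\<rho> (g \<otimes> h) v)))"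
    using v g by (simp add: l_rho_act rho_smult l_smult)
  also have "\<dots> = l (\<rho> g (c \<odot>\<^bsub>V\<^esub> act a v))"
    using v g by (simp add: l_rho_act rho_smult l_smult sum_distrib_left mult.left_commute)
  finally show "l (\<rho> g (act a (c \<odot>\<^bsub>V\<^esub> v))) = l (\<rho> g (c \<odot>\<^bsub>V\<^esub> act a v))" .
qed (use v in simp_all)

lemma act_cong: "v \<in> carrier V \<Longrightarrow> (\<And>x. x \<in> carrier G \<Longrightarrow> a x = b x) \<Longrightarrow> act a v = act b v"
  by (rule vector_eqI) (simp_all add: l_rho_act)

text \<open>The vectors \<open>act a v\<close> form the submodule \<open>F[G] v\<close>. It is
  invariant because a group element only translates the coefficient function, and it contains
  \<open>v\<close> through the delta function at \<open>\<one>\<close>.\<close>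

lemma cyclic:
  assumes v: "v \<in> carrier V" "v \<noteq> \<zero>\<^bsub>V\<^esub>" and w: "w \<in> carrier V"
  obtains a where "w = act a v"
proof -
  let ?S = "range (\<lambda>a. act a v)"
  have add: "act a v \<oplus>\<^bsub>V\<^esub> act b v = act (\<lambda>x. a x + b x) v" for a b
    by (rule vector_eqI) (simp_all add: v(1) l l_rho_act rho_add l_add sum.distrib distrib_right)
  have smult: "c \<odot>\<^bsub>V\<^esub> act a v = act (\<lambda>x. c * a x) v" for c a
    by (rule vector_eqI) (simp_all add: v(1) l l_rho_act rho_smult l_smult sum_distrib_left mult.assoc)
  have zero: "\<zero>\<^bsub>V\<^esub> = act (\<lambda>_. 0) v"
    using smult[of 0 "\<lambda>_. 0"] V.smult_l_null[of "act (\<lambda>_. 0) v"] v(1) by simp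
  have "subspace class_ring ?S V"
    using V.vectorspace_axioms V.module_axioms zero v(1)
    by (intro subspace.intro submodule.intro) (auto simp: add smult)
  moreover have "\<rho> g ` ?S \<subseteq> ?S" if g: "g \<in> carrier G" for g
  proof -
    have "\<rho> g (act a v) = act (\<lambda>x. a (inv g \<otimes> x)) v" for a
    proof (rule vector_eqI)
      fix h assume h: "h \<in> carrier G"
      have "l (\<rho> h (\<rho> g (act a v))) = (\<Sum>x\<in>carrier G. a x * l (\<rho> (h \<otimes> (g \<otimes> x)) v))"
        using g h v(1) l by (simp add: action_mult[symmetric] l_rho_act m_assoc)
      also have "\<dots> = l (\<rho> h (act (\<lambda>x. a (inv g \<otimes> x)) v))"
        using sum_left_translate[OF g, of "\<lambda>x. a (inv g \<otimes> x) * l (\<rho> (h \<otimes> x) v)"] g h v(1)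
        by (simp add: l_rho_act m_assoc[symmetric])
      finally show "l (\<rho> h (\<rho> g (act a v))) = l (\<rho> h (act (\<lambda>x. a (inv g \<otimes> x)) v))" .
    qed (use g v(1) in auto)
    then show ?thesis by blast
  qed
  ultimately have "?S = {\<zero>\<^bsub>V\<^esub>} \<or> ?S = carrier V"
    by (rule invariant_subspace)
  moreover have "act (\<lambda>x. if x = \<one> then 1 else 0) v = v"
    by (rule vector_eqI) (simp_all add: v(1) l finite_G l_rho_act if_distrib[of "\<lambda>c. c * _"] sum.delta cong: if_cong)
  then have "v \<in> ?S" by (metis rangeI)
  ultimately show ?thesis using v w that by blast
qed

text \<open>The weight \<open>\<theta> (inv u)\<close> cancels the factor \<open>\<theta> u\<close>
  that the functional picks up. The functional \<open>k\<close> is independent of the fixed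
  \<open>l\<close>, since two functionals are to be compared on the image of
  \<open>act idem\<close>.\<close>

lemma l_idem: "whittaker_functional k \<Longrightarrow> v \<in> carrier V \<Longrightarrow> k (act idem v) = k v"
proof -
  assume k: "whittaker_functional k" and v: "v \<in> carrier V"
  have "k (act idem v) = (\<Sum>h\<in>carrier G. idem h * k (\<rho> h v))"
    using l_act[OF k one_closed v, of idem] v action_one by simp
  also have "\<dots> = (\<Sum>u\<in>U. k v) / of_nat (card U)"
    using k v by (simp add: sum_idem wf_equiv[OF k] theta_inv mult.assoc[symmetric])
  finally show ?thesis using card_U by simp
qed

lemma act_idem_hecke: "hecke f \<Longrightarrow> v \<in> carrier V \<Longrightarrow> act idem (act f v) = act f v"
  by (simp add: act_conv conv_idem cong: act_cong)

text \<open>If \<open>w = act a v\<close> and both vectors are fixed by \<open>idem\<close>, then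
  \<open>a\<close> may be replaced by its sandwich between two copies of \<open>idem\<close>. This
  is the irreducibility of \<open>e \<pi>\<close> under \<open>e F[G] e\<close>.\<close>

lemma hecke_transitive:
  assumes v: "v \<in> carrier V" "v \<noteq> \<zero>\<^bsub>V\<^esub>" "act idem v = v" and w: "w \<in> carrier V" "act idem w = w"
  obtains h where "hecke h" "w = act h v"
proof -
  obtain a where "w = act a v" using cyclic[OF v(1,2) w(1)] .
  then have "w = act idem (act a (act idem v))" using v w by simp
  then have "w = act (conv idem (conv a idem)) v" using v(1) by (simp add: act_conv)
  then show ?thesis using that hecke_sandwich by blast
qed

text \<open>A nonzero polynomial of minimal degree in \<open>f\<close> that kills \<open>v\<close> has a linear factor, and the cofactor
  maps \<open>v\<close> to an eigenvector \<open>w\<close> of \<open>f\<close>. Since \<open>v = h w\<close> for a Hecke function \<open>h\<close> commuting with \<open>f\<close>,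
  also \<open>v\<close> is an eigenvector.\<close>

lemma hecke_acts_by_scalar:
  assumes comm: "\<And>a b x. hecke a \<Longrightarrow> hecke b \<Longrightarrow> x \<in> carrier G \<Longrightarrow> conv a b x = conv b a x"
    and v: "v \<in> carrier V" "v \<noteq> \<zero>\<^bsub>V\<^esub>" "act idem v = v" and f: "hecke f"
  shows "\<exists>c. act f v = c \<odot>\<^bsub>V\<^esub> v"
proof -
  define F where "F k = (conv f ^^ k) idem" for k
  have hecke_F: "hecke (F k)" for k
    by (induction k) (simp_all add: F_def hecke_idem hecke_conv f)
  \<comment> \<open>This is \<open>p\<close> evaluated at \<open>f\<close> in the algebra of Hecke
    functions. The unit there is \<open>idem\<close>, which is why
    \<open>F 0 = idem\<close>.\<close>
  define combination where "combination p x = (\<Sum>k\<le>degree p. coeff p k * F k x)" for p :: "'f poly" and x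
  have combination_eq: "combination p x = (\<Sum>k\<le>N. coeff p k * F k x)" if "degree p \<le> N" for p x N
    unfolding combination_def by (rule sum.mono_neutral_left) (use that in \<open>auto simp: coeff_eq_0\<close>)
  have hecke_combination: "hecke (combination p)" for p
    unfolding combination_def[abs_def] by (rule hecke_sum) (rule hecke_F)
  \<comment> \<open>Evaluation turns the factor \<open>X - c\<close> into convolution with
    \<open>f\<close> minus the scalar \<open>c\<close>; multiplication by \<open>X\<close> shifts
    coefficients and appears as \<open>pCons 0 q\<close>.\<close>
  have combination_linear_mult: "combination ([:- c, 1:] * q) x = conv f (combination q) x - c * combination q x" for c q x
  proof -
    let ?N = "Suc (degree q)"
    have "degree ([:- c, 1:] * q) \<le> ?N"
      by (rule order_trans[OF degree_mult_le]) simp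
    then have "combination ([:- c, 1:] * q) x = (\<Sum>k\<le>?N. coeff ([:- c, 1:] * q) k * F k x)"
      by (rule combination_eq)
    also have "\<dots> = (\<Sum>k\<le>?N. coeff (pCons 0 q) k * F k x - c * (coeff q k * F k x))"
      by (rule sum.cong) (simp_all add: algebra_simps)
    also have "\<dots> = (\<Sum>k\<le>?N. coeff (pCons 0 q) k * F k x) - c * (\<Sum>k\<le>?N. coeff q k * F k x)"
      by (simp only: sum_subtractf sum_distrib_left)
    also have "(\<Sum>k\<le>?N. coeff q k * F k x) = combination q x"
      by (rule combination_eq[symmetric]) simp
    also have "(\<Sum>k\<le>?N. coeff (pCons 0 q) k * F k x) = (\<Sum>k\<le>degree q. coeff q k * F (Suc k) x)"
      by (simp add: sum.atMost_Suc_shift del: sum.atMost_Suc)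
    also have "\<dots> = (\<Sum>k\<le>degree q. \<Sum>y\<in>carrier G. f y * (coeff q k * F k (inv y \<otimes> x)))"
      by (simp add: F_def conv_def sum_distrib_left mult.left_commute)
    also have "\<dots> = conv f (combination q) x"
      by (subst sum.swap) (simp add: conv_def combination_def sum_distrib_left)
    finally show ?thesis .
  qed
  have act_diff: "act (\<lambda>x. a x - c * b x) v = act a v \<oplus>\<^bsub>V\<^esub> (- c) \<odot>\<^bsub>V\<^esub> act b v" for a b c
    by (rule vector_eqI)
       (simp_all add: v(1) l_rho_act rho_add rho_smult l_add l_smult sum_distrib_left sum_subtractf sum_negf left_diff_distrib mult.assoc)
  have act_zero: "act a v = \<zero>\<^bsub>V\<^esub>" if "\<And>x. x \<in> carrier G \<Longrightarrow> a x = 0" for a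
    by (rule kernel_zero) (simp_all add: v(1) l_rho_act that)
  let ?P = "\<lambda>p. p \<noteq> 0 \<and> act (combination p) v = \<zero>\<^bsub>V\<^esub>"
  \<comment> \<open>An annihilating polynomial exists because the functions \<open>F k\<close> live
    on the finite set \<open>carrier G\<close>, whatever the dimension of \<open>V\<close>.\<close>
  obtain p0 where "p0 \<noteq> 0" "\<forall>x\<in>carrier G. combination p0 x = 0"
    using exists_poly_combination_zero[OF finite_G, of F] unfolding combination_def by blast
  then have "\<exists>p. ?P p" using act_zero by blast
  then obtain p where p: "p \<noteq> 0" "act (combination p) v = \<zero>\<^bsub>V\<^esub>"
    and min: "\<And>q. ?P q \<Longrightarrow> degree p \<le> degree q"
    using ex_has_least_nat[of ?P _ degree] by blast
  \<comment> \<open>A nonzero constant acts on \<open>v\<close> as a nonzero scalar, because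
    \<open>F 0 = idem\<close> fixes \<open>v\<close>.\<close>
  have "degree p > 0"
  proof (rule ccontr)
    assume "\<not> degree p > 0"
    then obtain a where a: "p = [:a:]" by (auto elim: degree_eq_zeroE)
    have "act (combination p) v = a \<odot>\<^bsub>V\<^esub> act idem v"
      by (rule vector_eqI) (simp_all add: v(1) l_rho_act rho_smult l_smult combination_def a F_def sum_distrib_left mult.assoc)
    then have av: "a \<odot>\<^bsub>V\<^esub> v = \<zero>\<^bsub>V\<^esub>" using p(2) v(3) by simp
    then have "l (\<rho> g v) = 0" if "g \<in> carrier G" for g
    proof -
      have "a * l (\<rho> g v) = l (\<rho> g (a \<odot>\<^bsub>V\<^esub> v))"
        using that v(1) by (simp add: rho_smult l_smult)
      also have "\<dots> = l (\<rho> g (act (\<lambda>_. 0) v))"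
        using av act_zero[of "\<lambda>_. 0"] by simp
      also have "\<dots> = 0" using that v(1) by (simp add: l_rho_act)
      finally show ?thesis using p(1) a by simp
    qed
    with kernel_zero[OF v(1)] v(2) show False by blast
  qed
  then obtain c q where q: "p = [:- c, 1:] * q" "q \<noteq> 0" and deg: "degree p = Suc (degree q)"
    using alg_closed_linear_factor by metis
  define w where "w = act (combination q) v"
  have wV: "w \<in> carrier V" unfolding w_def by (rule act_in[OF v(1)])
  have w0: "w \<noteq> \<zero>\<^bsub>V\<^esub>" using min[of q] q(2) deg unfolding w_def by linarith
  have wi: "act idem w = w" unfolding w_def by (rule act_idem_hecke[OF hecke_combination v(1)])
  have "act (combination p) v = act (\<lambda>x. conv f (combination q) x - c * combination q x) v"
    unfolding q(1) by (rule act_cong[OF v(1)]) (rule combination_linear_mult)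
  also have "\<dots> = act f w \<oplus>\<^bsub>V\<^esub> (- c) \<odot>\<^bsub>V\<^esub> w"
    unfolding act_diff w_def act_conv[OF v(1)] ..
  also have "(- c) \<odot>\<^bsub>V\<^esub> w = (- 1) \<odot>\<^bsub>V\<^esub> (c \<odot>\<^bsub>V\<^esub> w)"
    using V.smult_assoc1[of "- 1" c w] wV by simp
  finally have sub0: "act f w \<oplus>\<^bsub>V\<^esub> (- 1) \<odot>\<^bsub>V\<^esub> (c \<odot>\<^bsub>V\<^esub> w) = \<zero>\<^bsub>V\<^esub>"
    using p(2) by simp
  have eig: "act f w = c \<odot>\<^bsub>V\<^esub> w"
    by (rule eq_if_diff_zero[OF act_in[OF wV] smult_in[OF wV] sub0])
  obtain h where h: "hecke h" "v = act h w"
    using hecke_transitive[OF wV w0 wi v(1,3)] .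
  have "act f v = act (conv f h) w"
    unfolding h(2) by (rule act_conv[OF wV])
  also have "\<dots> = act (conv h f) w"
    by (rule act_cong[OF wV]) (rule comm[OF f h(1)])
  also have "\<dots> = act h (act f w)"
    by (rule act_conv[OF wV, symmetric])
  also have "\<dots> = c \<odot>\<^bsub>V\<^esub> v" unfolding eig h(2) by (rule act_smult[OF wV])
  finally show ?thesis by blast
qed

end

text \<open>Both functionals factor through \<open>act idem\<close>, whose image is spanned by the
  single vector \<open>w\<close>: a Hecke function carries \<open>w\<close> to any given vector of
  the image, and it acts on \<open>w\<close> by a scalar.\<close>

lemma whittaker_functional_unique:
  assumes comm: "\<And>a b x. hecke a \<Longrightarrow> hecke b \<Longrightarrow> x \<in> carrier G \<Longrightarrow> conv a b x = conv b a x"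
    and l: "whittaker_functional l" and v0: "v0 \<in> carrier V" "l v0 \<noteq> 0"
    and k: "whittaker_functional k"
  shows "\<exists>c. \<forall>v\<in>carrier V. k v = c * l v"
proof -
  define w where "w = act idem v0"
  have w: "w \<in> carrier V" using v0 by (simp add: w_def)
  have wi: "act idem w = w"
    using act_idem_hecke[OF l v0 hecke_idem v0(1)] by (simp add: w_def)
  have lw: "l w = l v0" using l_idem[OF l v0 l v0(1)] by (simp add: w_def)
  then have w0: "w \<noteq> \<zero>\<^bsub>V\<^esub>" using v0 wf_zero[OF l] by auto
  \<comment> \<open>The ratio is forced by the values at \<open>w\<close>, where
    \<open>l w = l v0\<close> is nonzero.\<close>
  have "k v = (k w / l w) * l v" if v: "v \<in> carrier V" for v
  proof -
    have av: "act idem v \<in> carrier V" using v by simp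
    have "act idem (act idem v) = act idem v"
      using act_idem_hecke[OF l v0 hecke_idem v] .
    then obtain h where h: "hecke h" "act idem v = act h w"
      using hecke_transitive[OF l v0 w w0 wi av] by blast
    obtain c where c: "act h w = c \<odot>\<^bsub>V\<^esub> w"
      using hecke_acts_by_scalar[OF l v0 comm w w0 wi h(1)] by blast
    have "k v = c * k w" "l v = c * l w"
      using l_idem[OF l v0 k v] l_idem[OF l v0 l v] wf_smult[OF k w] wf_smult[OF l w] by (simp_all add: h c)
    then show ?thesis using lw v0 by simp
  qed
  then show ?thesis by blast
qed

end

section \<open>The induced representation\<close>

text \<open>The homomorphism from the free abelian group to the field that extends \<open>k\<close>;
  maps out of the tensor product are built from it.\<close>

definition frag_eval :: "('s \<Rightarrow> 'f :: field) \<Rightarrow> ('s \<Rightarrow>\<^sub>0 int) \<Rightarrow> 'f"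
  where "frag_eval k x = (\<Sum>s\<in>Poly_Mapping.keys x. of_int (Poly_Mapping.lookup x s) * k s)"

lemma frag_eval_superset:
  assumes "finite S" "Poly_Mapping.keys x \<subseteq> S"
  shows "frag_eval k x = (\<Sum>s\<in>S. of_int (Poly_Mapping.lookup x s) * k s)"
  unfolding frag_eval_def by (rule sum.mono_neutral_left) (use assms in \<open>auto simp: in_keys_iff\<close>)

lemma frag_eval_zero [simp]: "frag_eval k 0 = 0"
  by (simp add: frag_eval_def)

lemma frag_eval_of [simp]: "frag_eval k (frag_of s) = k s"
  by (simp add: frag_eval_def)

lemma frag_eval_add: "frag_eval k (x + y) = frag_eval k x + frag_eval k y"
proof -
  let ?S = "Poly_Mapping.keys x \<union> Poly_Mapping.keys y"
  have "Poly_Mapping.keys (x + y) \<subseteq> ?S" by (rule keys_add)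
  then show ?thesis
    by (simp add: frag_eval_superset[of ?S] lookup_add distrib_right sum.distrib)
qed

lemma frag_eval_minus: "frag_eval k (- x) = - frag_eval k x"
  using frag_eval_add[of k x "- x"] by (simp add: eq_neg_iff_add_eq_0 add.commute)

lemma frag_eval_diff: "frag_eval k (x - y) = frag_eval k x - frag_eval k y"
  using frag_eval_add[of k x "- y"] by (simp add: frag_eval_minus)

lemma keys_diff_subset: "Poly_Mapping.keys x \<subseteq> S \<Longrightarrow> Poly_Mapping.keys y \<subseteq> S \<Longrightarrow>
   Poly_Mapping.keys (x - y) \<subseteq> S" for x y :: "'s \<Rightarrow>\<^sub>0 int"
  using keys_diff[of x y] by blast

lemma keys_add_subset: "Poly_Mapping.keys x \<subseteq> S \<Longrightarrow> Poly_Mapping.keys y \<subseteq> S \<Longrightarrow>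
   Poly_Mapping.keys (x + y) \<subseteq> S" for x y :: "'s \<Rightarrow>\<^sub>0 int"
  using keys_add[of x y] by blast

lemma frag_eval_extend:
  assumes "Poly_Mapping.keys x \<subseteq> S" "\<And>s. s \<in> S \<Longrightarrow> frag_eval k (b s) = c * k' s"
  shows "frag_eval k (frag_extend b x) = c * frag_eval k' x"
  using assms(1)
  by (induction x rule: frag_induction)
     (simp_all add: assms(2) frag_extend_diff frag_eval_diff right_diff_distrib)

lemma vectorspace_line: "vectorspace class_ring (line (class_ring :: 'f :: field ring))"
proof -
  have "\<exists>y. y + x = 0" for x :: 'f by (rule exI[of _ "- x"]) simp
  then have "abelian_group (line (class_ring :: 'f ring))"
    by (intro abelian_groupI) (auto simp: line_def algebra_simps)
  then have "Module.module class_ring (line (class_ring :: 'f ring))"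
    by (intro moduleI class_cring.is_cring) (auto simp: line_def algebra_simps)
  then show ?thesis
    by (simp add: vectorspace_def class_field)
qed

lemma line_simps [simp]: "carrier (line class_ring) = UNIV" "x \<oplus>\<^bsub>line class_ring\<^esub> y = x + y"
   "x \<odot>\<^bsub>line class_ring\<^esub> y = x * y" "\<zero>\<^bsub>line class_ring\<^esub> = 0"
  by (simp_all add: line_def)

lemma finsum_line [simp]: "finsum (line (class_ring :: 'f :: field ring)) f A = sum f A"
proof -
  interpret vectorspace class_ring "line (class_ring :: 'f ring)" by (rule vectorspace_line)
  show ?thesis
    by (induction A rule: infinite_finite_induct)
       (simp_all add: M.finsum_infinite M.finsum_insert)
qed

section \<open>The tensor product realized by functions on the group\<close>

context multiplicative_character
begin

abbreviation "FG \<equiv> group_algebra (class_ring :: 'f ring) G"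
abbreviation "FU \<equiv> group_algebra (class_ring :: 'f ring) (G\<lparr>carrier := U\<rparr>)"
abbreviation "char_line \<equiv> line (class_ring :: 'f ring)"
abbreviation "right_U \<equiv> right_mult_action (class_ring :: 'f ring) G U"
abbreviation "left_U \<equiv> linear_extension U char_line (character_action class_ring \<theta>)"
abbreviation "ind_rel \<equiv> tensor_relations FU FG right_U char_line left_U"
abbreviation "ind_free \<equiv> free_Abelian_group (carrier FG \<times> carrier char_line)"

lemma carrier_FG: "a \<in> carrier FG \<longleftrightarrow> a \<in> extensional (carrier G)"
  by (simp add: group_algebra_def PiE_def)

lemma FG_add: "a \<oplus>\<^bsub>FG\<^esub> b = (\<lambda>x\<in>carrier G. a x + b x)"
  by (simp add: group_algebra_def)

lemma left_U_eq: "left_U b w = (\<Sum>u\<in>U. b u * \<theta> u) * w"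
  by (simp add: linear_extension_def character_action_def sum_distrib_right mult.assoc)

lemma right_U_eq:
  assumes "x \<in> carrier G"
  shows "right_U a b x = (\<Sum>u\<in>U. a (x \<otimes> inv u) * b u)"
proof -
  have "right_U a b x = (\<Sum>y\<in>carrier G. a y * (if inv y \<otimes> x \<in> U then b (inv y \<otimes> x) else 0))"
    using assms by (simp add: right_mult_action_def group_algebra_def group_algebra_incl_def
        class_ring_simps cong: if_cong)
  also have "\<dots> = (\<Sum>y\<in>{y \<in> carrier G. inv y \<otimes> x \<in> U}. a y * b (inv y \<otimes> x))"
    by (rule sum.mono_neutral_cong_right) (use finite_G in auto)
  also have "\<dots> = (\<Sum>u\<in>U. a (x \<otimes> inv u) * b u)"
  proof (rule sum.reindex_bij_witness[of _ "\<lambda>u. x \<otimes> inv u" "\<lambda>y. inv y \<otimes> x"])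
    fix y assume y: "y \<in> {y \<in> carrier G. inv y \<otimes> x \<in> U}"
    then show 1: "x \<otimes> inv (inv y \<otimes> x) = y"
      using assms by (simp add: inv_mult_group m_assoc[symmetric])
    show "a (x \<otimes> inv (inv y \<otimes> x)) * b (inv y \<otimes> x) = a y * b (inv y \<otimes> x)"
      by (simp only: 1)
  next
    fix u assume u: "u \<in> U"
    show 2: "inv (x \<otimes> inv u) \<otimes> x = u"
      using assms U_sub[OF u] by (simp add: inv_mult_group m_assoc)
    show "x \<otimes> inv u \<in> {y \<in> carrier G. inv y \<otimes> x \<in> U}"
      using 2 u assms U_sub[OF u] by simp
  qed auto
  finally show ?thesis .
qed

lemma right_U_in: "right_U a b \<in> carrier FG"
  by (simp add: right_mult_action_def group_algebra_def)

text \<open>The coefficient at \<open>g\<close> of \<open>c a \<Sum> \<theta>(u\<^sup>-\<^sup>1) u\<close>, where \<open>u\<close> ranges over \<open>U\<close>.\<close>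

definition ind_eval :: "'g \<Rightarrow> ('g \<Rightarrow> 'f) \<times> 'f \<Rightarrow> 'f"
  where "ind_eval g = (\<lambda>(a, c). c * (\<Sum>u\<in>U. a (g \<otimes> u) * \<theta> u))"

lemma sum_U_translate: "w \<in> U \<Longrightarrow> (\<Sum>u\<in>U. (F (w \<otimes> u) :: 'f)) = (\<Sum>u\<in>U. F u)"
  "w \<in> U \<Longrightarrow> (\<Sum>u\<in>U. (F (u \<otimes> w) :: 'f)) = (\<Sum>u\<in>U. F u)"
  subgoal
    by (rule sum.reindex_bij_witness[of _ "\<lambda>u. inv w \<otimes> u" "\<lambda>u. w \<otimes> u"])
       (auto simp: m_assoc[symmetric] U_sub U_mult U_inv)
  subgoal
    by (rule sum.reindex_bij_witness[of _ "\<lambda>u. u \<otimes> inv w" "\<lambda>u. u \<otimes> w"])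
       (auto simp: m_assoc U_sub U_mult U_inv)
  done

text \<open>The sum of all \<open>\<theta> (inv u) u\<close> absorbs \<open>b\<close> in
  \<open>F[U]\<close> from the left up to the scalar \<open>\<Sum> b(u) \<theta>(u)\<close>, which
  is the scalar by which \<open>left_U b\<close> acts on the line.\<close>

lemma ind_eval_balanced:
  assumes g: "g \<in> carrier G"
  shows "ind_eval g (right_U a b, c) = ind_eval g (a, left_U b c)"
proof -
  have "(\<Sum>u\<in>U. right_U a b (g \<otimes> u) * \<theta> u) = (\<Sum>u\<in>U. \<Sum>w\<in>U. a (g \<otimes> u \<otimes> inv w) * b w * \<theta> u)"
    using g U_sub by (intro sum.cong refl) (simp add: right_U_eq sum_distrib_right)
  also have "\<dots> = (\<Sum>w\<in>U. \<Sum>u\<in>U. a (g \<otimes> u \<otimes> inv w) * b w * \<theta> u)"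
    by (rule sum.swap)
  also have "\<dots> = (\<Sum>w\<in>U. \<Sum>u\<in>U. a (g \<otimes> u) * b w * (\<theta> u * \<theta> w))"
  proof (rule sum.cong)
    fix w assume w: "w \<in> U"
    show "(\<Sum>u\<in>U. a (g \<otimes> u \<otimes> inv w) * b w * \<theta> u) = (\<Sum>u\<in>U. a (g \<otimes> u) * b w * (\<theta> u * \<theta> w))"
      unfolding sum_U_translate(2)[OF w, of "\<lambda>u. a (g \<otimes> u \<otimes> inv w) * b w * \<theta> u", symmetric]
      by (rule sum.cong) (use g w U_sub in \<open>simp_all add: m_assoc theta_mult\<close>)
  qed simp
  also have "\<dots> = (\<Sum>u\<in>U. b u * \<theta> u) * (\<Sum>u\<in>U. a (g \<otimes> u) * \<theta> u)"
    by (simp add: sum_product mult_ac)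
  finally show ?thesis by (simp add: ind_eval_def left_U_eq mult_ac)
qed

abbreviation "ind_gens \<equiv>
  {frag_of (x \<oplus>\<^bsub>FG\<^esub> y, n) - frag_of (x, n) - frag_of (y, n) | x y n.
          x \<in> carrier FG \<and> y \<in> carrier FG \<and> n \<in> carrier char_line}
       \<union> {frag_of (m, x \<oplus>\<^bsub>char_line\<^esub> y) - frag_of (m, x) - frag_of (m, y) | m x y.
          m \<in> carrier FG \<and> x \<in> carrier char_line \<and> y \<in> carrier char_line}
       \<union> {frag_of (right_U m a, n) - frag_of (m, left_U a n) | m a n.
          m \<in> carrier FG \<and> a \<in> carrier FU \<and> n \<in> carrier char_line}"

lemma ind_rel_eq: "ind_rel = generate ind_free ind_gens"
  unfolding tensor_relations_def ..

lemma ind_gens_subset: "ind_gens \<subseteq> carrier ind_free"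
proof
  fix x assume "x \<in> ind_gens"
  then have "Poly_Mapping.keys x \<subseteq> carrier FG \<times> carrier char_line"
    using right_U_in
    by (elim UnE CollectE exE conjE; hypsubst; intro keys_diff_subset)
       (auto simp: FG_add carrier_FG)
  then show "x \<in> carrier ind_free" by simp
qed

lemma ind_rel_subgroup: "subgroup ind_rel ind_free"
  unfolding ind_rel_eq by (rule group.generate_is_subgroup[OF group_free_Abelian_group ind_gens_subset])

lemma ind_rel_keys: "x \<in> ind_rel \<Longrightarrow> Poly_Mapping.keys x \<subseteq> carrier FG \<times> UNIV"
  using subgroup.mem_carrier[OF ind_rel_subgroup, of x] by simp

lemma ind_rel_zero: "0 \<in> ind_rel"
  using subgroup.one_closed[OF ind_rel_subgroup] by simp

lemma ind_rel_add: "x \<in> ind_rel \<Longrightarrow> y \<in> ind_rel \<Longrightarrow> x + y \<in> ind_rel"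
  using subgroup.m_closed[OF ind_rel_subgroup, of x y] by simp

lemma ind_rel_minus: "x \<in> ind_rel \<Longrightarrow> - x \<in> ind_rel"
  using subgroup.m_inv_closed[OF ind_rel_subgroup, of x] ind_rel_keys[of x] by simp

lemma ind_rel_diff: "x \<in> ind_rel \<Longrightarrow> y \<in> ind_rel \<Longrightarrow> x - y \<in> ind_rel"
  using ind_rel_add[OF _ ind_rel_minus] by fastforce

lemma ind_rel_add_left:
  "x \<in> carrier FG \<Longrightarrow> y \<in> carrier FG \<Longrightarrow> frag_of (x \<oplus>\<^bsub>FG\<^esub> y, n) - frag_of (x, n) - frag_of (y, n) \<in> ind_rel"
  unfolding ind_rel_eq by (rule generate.incl) auto

lemma ind_rel_balance:
  "m \<in> carrier FG \<Longrightarrow> a \<in> carrier FU \<Longrightarrow> frag_of (right_U m a, n) - frag_of (m, left_U a n) \<in> ind_rel"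
  unfolding ind_rel_eq by (rule generate.incl) auto

lemma ind_rel_eval:
  assumes "x \<in> ind_rel" "g \<in> carrier G"
  shows "frag_eval (ind_eval g) x = 0"
  using assms(1) unfolding ind_rel_eq
proof (induction x rule: generate.induct)
  case (incl h)
  then show ?case
    using assms(2) U_sub
    by (auto simp: frag_eval_diff ind_eval_balanced)
       (auto simp: ind_eval_def FG_add algebra_simps sum.distrib)
next
  case (inv h)
  then have "h \<in> carrier ind_free" using ind_gens_subset by blast
  then have eq: "inv\<^bsub>ind_free\<^esub> h = - h" by simp
  have "frag_eval (ind_eval g) h = 0"
    using inv assms(2) U_sub
    by (auto simp: frag_eval_diff ind_eval_balanced)
       (auto simp: ind_eval_def FG_add algebra_simps sum.distrib)
  then show ?case unfolding eq by (simp add: frag_eval_minus)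
qed (simp_all add: frag_eval_add)

definition ind_normal :: "(('g \<Rightarrow> 'f) \<times> 'f \<Rightarrow>\<^sub>0 int) \<Rightarrow> 'g \<Rightarrow> 'f"
  where "ind_normal x = (\<lambda>g\<in>carrier G. frag_eval (\<lambda>(a, c). c * a g) x)"

lemma ind_normal_in: "ind_normal x \<in> carrier FG"
  by (simp add: ind_normal_def carrier_FG)

lemma carrier_FU: "a \<in> carrier FU \<longleftrightarrow> a \<in> extensional U"
  by (simp add: group_algebra_def PiE_def)

lemma sum_U_delta: "(\<Sum>u\<in>U. (if u = \<one> then F u else 0)) = (F \<one> :: 'f)"
  using sum.delta[OF finite_U, of \<one> F] U_one by simp

text \<open>A generator \<open>a \<otimes> c\<close> equals \<open>c a \<otimes> 1\<close>, by
  balancing with \<open>c\<close> times the identity of \<open>F[U]\<close>; additivity on the left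
  then merges a formal sum into one pure tensor.\<close>

lemma ind_rel_normal:
  assumes "Poly_Mapping.keys x \<subseteq> carrier FG \<times> UNIV"
  shows "x - frag_of (ind_normal x, 1) \<in> ind_rel"
  using assms
proof (induction x rule: frag_induction)
  case zero
  \<comment> \<open>A function \<open>z\<close> with \<open>z + z = z\<close> has
    \<open>- (z \<otimes> 1)\<close> among the relations, by additivity on the left.\<close>
  have "ind_normal 0 \<oplus>\<^bsub>FG\<^esub> ind_normal 0 = ind_normal 0"
    by (auto simp: ind_normal_def FG_add)
  then show ?case
    using ind_rel_add_left[OF ind_normal_in ind_normal_in, of 0 0 1] by simp
next
  case (one s)
  then obtain a c where s: "s = (a, c)" and a: "a \<in> carrier FG" by auto
  \<comment> \<open>This is \<open>c\<close> times the identity of \<open>F[U]\<close>.\<close>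
  let ?b = "\<lambda>u\<in>U. if u = \<one> then c else 0"
  have b: "?b \<in> carrier FU" by (simp add: carrier_FU)
  have "left_U ?b 1 = (\<Sum>u\<in>U. if u = \<one> then c * \<theta> u else 0)"
    by (simp add: left_U_eq if_distrib[of "\<lambda>x. x * _"] cong: if_cong)
  then have left: "left_U ?b 1 = c" by (simp add: sum_U_delta theta_one)
  have "right_U a ?b g = ind_normal (frag_of s) g" if "g \<in> carrier G" for g
  proof -
    have "right_U a ?b g = (\<Sum>u\<in>U. if u = \<one> then a (g \<otimes> inv u) * c else 0)"
      using that by (simp add: right_U_eq if_distrib[of "\<lambda>x. _ * x"] cong: if_cong)
    then show ?thesis using that by (simp add: sum_U_delta ind_normal_def s)
  qed
  then have right: "right_U a ?b = ind_normal (frag_of s)"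
    using right_U_in[of a ?b] ind_normal_in[of "frag_of s"] unfolding carrier_FG
    by (rule_tac extensionalityI) auto
  have "- (frag_of (ind_normal (frag_of s), 1) - frag_of s) \<in> ind_rel"
    using ind_rel_minus[OF ind_rel_balance[OF a b, of 1]] by (simp only: left right s)
  then show ?case by simp
next
  case (diff x y)
  have eq: "ind_normal (x - y) \<oplus>\<^bsub>FG\<^esub> ind_normal y = ind_normal x"
    by (auto simp: ind_normal_def FG_add frag_eval_diff)
  have "frag_of (ind_normal x, 1) - frag_of (ind_normal (x - y), 1) - frag_of (ind_normal y, 1) \<in> ind_rel"
    using ind_rel_add_left[OF ind_normal_in ind_normal_in, of "x - y" y 1] by (simp only: eq)
  from ind_rel_add[OF ind_rel_diff[OF diff] this] show ?case
    by (simp add: algebra_simps)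
qed

text \<open>The converse of \<open>ind_rel_eval\<close> is the injectivity of the embedding into
  \<open>F[G]\<close>. Modulo the relations, \<open>x\<close> is
  \<open>n \<otimes> 1 = n \<otimes> e 1 = n e \<otimes> 1\<close> with
  \<open>n = ind_normal x\<close> and the idempotent \<open>e\<close>, and vanishing evaluations say
  that \<open>n e = 0\<close>.\<close>

lemma ind_rel_iff:
  "x \<in> ind_rel \<longleftrightarrow> Poly_Mapping.keys x \<subseteq> carrier FG \<times> UNIV \<and> (\<forall>g\<in>carrier G. frag_eval (ind_eval g) x = 0)"
proof (intro iffI conjI ballI)
  assume "Poly_Mapping.keys x \<subseteq> carrier FG \<times> UNIV \<and> (\<forall>g\<in>carrier G. frag_eval (ind_eval g) x = 0)"
  then have keys: "Poly_Mapping.keys x \<subseteq> carrier FG \<times> UNIV"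
    and 0: "\<forall>g\<in>carrier G. frag_eval (ind_eval g) x = 0" by blast+
  let ?n = "ind_normal x"
  \<comment> \<open>The idempotent \<open>e\<close> as an element of \<open>F[U]\<close>; it acts on
    the line as \<open>1\<close>.\<close>
  let ?b = "\<lambda>u\<in>U. \<theta> (inv u) / of_nat (card U)"
  have b: "?b \<in> carrier FU" by (simp add: carrier_FU)
  have left: "left_U ?b 1 = 1"
    using card_U by (simp add: left_U_eq theta_inv)
  have "right_U ?n ?b g = 0" if g: "g \<in> carrier G" for g
  proof -
    have "frag_eval (ind_eval g) (x - frag_of (?n, 1)) = 0"
      by (rule ind_rel_eval[OF ind_rel_normal[OF keys] g])
    then have "(\<Sum>u\<in>U. ?n (g \<otimes> u) * \<theta> u) = 0"
      using 0 g by (simp add: frag_eval_diff) (simp add: ind_eval_def)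
    moreover have "(\<Sum>u\<in>U. ?n (g \<otimes> u) * \<theta> u) = (\<Sum>u\<in>U. ?n (g \<otimes> inv u) * \<theta> (inv u))"
      by (rule sum.reindex_bij_witness[of _ "\<lambda>u. inv u" "\<lambda>u. inv u"]) (auto simp: U_inv U_sub)
    ultimately have "(\<Sum>u\<in>U. ?n (g \<otimes> inv u) * \<theta> (inv u)) / of_nat (card U) = 0" by simp
    then show ?thesis using g by (simp add: right_U_eq sum_divide_distrib)
  qed
  \<comment> \<open>The zero function is its own double, so additivity makes its pure tensor a
    relation.\<close>
  then have "right_U ?n ?b \<oplus>\<^bsub>FG\<^esub> right_U ?n ?b = right_U ?n ?b"
    using right_U_in[of ?n ?b] unfolding carrier_FG
    by (intro extensionalityI[of _ "carrier G"]) (auto simp: FG_add)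
  then have N: "- frag_of (right_U ?n ?b, 1) \<in> ind_rel"
    using ind_rel_add_left[OF right_U_in right_U_in, of ?n ?b ?n ?b 1] by simp
  have B: "frag_of (right_U ?n ?b, 1) - frag_of (?n, 1) \<in> ind_rel"
    using ind_rel_balance[OF ind_normal_in b, of x 1] by (simp only: left)
  have "frag_of (?n, 1) \<in> ind_rel"
    using ind_rel_minus[OF ind_rel_add[OF B N]] by simp
  with ind_rel_normal[OF keys] show "x \<in> ind_rel"
    using ind_rel_add[of "x - frag_of (ind_normal x, 1)" "frag_of (ind_normal x, 1)"] by simp
qed (fact ind_rel_keys ind_rel_eval)+

definition ind_coset :: "(('g \<Rightarrow> 'f) \<times> 'f \<Rightarrow>\<^sub>0 int) \<Rightarrow> (('g \<Rightarrow> 'f) \<times> 'f \<Rightarrow>\<^sub>0 int) set"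
  where "ind_coset x = ind_rel #>\<^bsub>ind_free\<^esub> x"

lemma ind_coset_eq: "ind_coset x = (\<lambda>r. r + x) ` ind_rel"
  by (auto simp: ind_coset_def r_coset_def)

lemma ind_coset_self: "x \<in> ind_coset x"
  using ind_rel_zero by (force simp: ind_coset_eq)

lemma ind_coset_eqI:
  assumes "x - y \<in> ind_rel"
  shows "ind_coset x = ind_coset y"
proof -
  have "r + x \<in> (\<lambda>r. r + y) ` ind_rel" if "r \<in> ind_rel" "x - y \<in> ind_rel" for r x y
    using ind_rel_add[OF that] by (intro image_eqI[of _ _ "r + (x - y)"]) auto
  from this[OF _ assms] this[of _ y x] show ?thesis
    using ind_rel_minus[OF assms] unfolding ind_coset_eq by auto
qed

abbreviation "Ind \<equiv> Ind_space class_ring G U char_line (character_action class_ring \<theta>)"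
abbreviation "ind_act \<equiv> Ind_action class_ring G U char_line (character_action class_ring \<theta>)"
abbreviation "ind_lift \<equiv> Ind_map class_ring G U char_line (character_action class_ring \<theta>)"
abbreviation "ind_group \<equiv> Ind_tensor class_ring G U char_line (character_action class_ring \<theta>)"

lemma ind_group_eq: "ind_group = ind_free Mod ind_rel"
  by (simp add: Ind_tensor_def tensor_product_def)

lemma carrier_Ind: "carrier Ind = ind_coset ` {x. Poly_Mapping.keys x \<subseteq> carrier FG \<times> UNIV}"
  by (auto simp: Ind_space_def ind_group_eq FactGroup_def RCOSETS_def ind_coset_def)

lemma Ind_cases:
  assumes "w \<in> carrier Ind"
  obtains x where "Poly_Mapping.keys x \<subseteq> carrier FG \<times> UNIV" "w = ind_coset x"
  using assms by (auto simp: carrier_Ind)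

lemma Ind_zero: "\<zero>\<^bsub>Ind\<^esub> = ind_coset 0"
  by (simp add: Ind_space_def ind_group_eq FactGroup_def ind_coset_eq)

lemma Ind_add: "ind_coset x \<oplus>\<^bsub>Ind\<^esub> ind_coset y = ind_coset (x + y)"
proof -
  have "ind_coset x \<oplus>\<^bsub>Ind\<^esub> ind_coset y = (\<Union>r\<in>ind_rel. \<Union>s\<in>ind_rel. {(r + x) + (s + y)})"
    by (simp add: Ind_space_def ind_group_eq FactGroup_def ind_coset_eq set_mult_def)
  also have "\<dots> = ind_coset (x + y)"
  proof (intro equalityI subsetI)
    fix z assume "z \<in> (\<Union>r\<in>ind_rel. \<Union>s\<in>ind_rel. {(r + x) + (s + y)})"
    then obtain r s where "r \<in> ind_rel" "s \<in> ind_rel" "z = (r + s) + (x + y)"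
      by (auto simp: algebra_simps)
    then show "z \<in> ind_coset (x + y)" using ind_rel_add unfolding ind_coset_eq by blast
  next
    fix z assume "z \<in> ind_coset (x + y)"
    then obtain r where "r \<in> ind_rel" "z = (r + x) + (0 + y)"
      by (auto simp: ind_coset_eq algebra_simps)
    then show "z \<in> (\<Union>r\<in>ind_rel. \<Union>s\<in>ind_rel. {(r + x) + (s + y)})"
      using ind_rel_zero by blast
  qed
  finally show ?thesis .
qed

text \<open>This is \<open>card U\<close> times the embedding
  \<open>a \<otimes> c \<mapsto> c a e\<close>. The chosen representative is immaterial because
  relations evaluate to zero.\<close>

definition ind_fun :: "(('g \<Rightarrow> 'f) \<times> 'f \<Rightarrow>\<^sub>0 int) set \<Rightarrow> 'g \<Rightarrow> 'f"
  where "ind_fun C g = frag_eval (ind_eval g) (SOME x. x \<in> C)"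

lemma ind_fun_coset:
  assumes "g \<in> carrier G"
  shows "ind_fun (ind_coset x) g = frag_eval (ind_eval g) x"
proof -
  have "(SOME y. y \<in> ind_coset x) \<in> ind_coset x"
    using ind_coset_self by (rule someI)
  then obtain r where "r \<in> ind_rel" "(SOME y. y \<in> ind_coset x) = r + x"
    unfolding ind_coset_eq by blast
  then show ?thesis
    by (simp add: ind_fun_def frag_eval_add ind_rel_eval assms)
qed

lemma Ind_eqI:
  assumes "w \<in> carrier Ind" "w' \<in> carrier Ind"
    and "\<And>g. g \<in> carrier G \<Longrightarrow> ind_fun w g = ind_fun w' g"
  shows "w = w'"
proof -
  obtain x y where x: "Poly_Mapping.keys x \<subseteq> carrier FG \<times> UNIV" "w = ind_coset x"
    and y: "Poly_Mapping.keys y \<subseteq> carrier FG \<times> UNIV" "w' = ind_coset y"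
    using Ind_cases assms(1,2) by metis
  have "x - y \<in> ind_rel"
    using assms(3) keys_diff_subset[OF x(1) y(1)]
    by (simp add: ind_rel_iff frag_eval_diff ind_fun_coset x(2) y(2))
  then show ?thesis unfolding x(2) y(2) by (rule ind_coset_eqI)
qed

lemma Ind_add_closed: "w \<in> carrier Ind \<Longrightarrow> w' \<in> carrier Ind \<Longrightarrow> w \<oplus>\<^bsub>Ind\<^esub> w' \<in> carrier Ind"
  by (elim Ind_cases; hypsubst; unfold Ind_add carrier_Ind; intro imageI CollectI keys_add_subset)

lemma ind_fun_add: "w \<in> carrier Ind \<Longrightarrow> w' \<in> carrier Ind \<Longrightarrow> g \<in> carrier G \<Longrightarrow>
    ind_fun (w \<oplus>\<^bsub>Ind\<^esub> w') g = ind_fun w g + ind_fun w' g"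
  by (elim Ind_cases) (simp add: Ind_add ind_fun_coset frag_eval_add)

lemma Ind_zero_closed: "\<zero>\<^bsub>Ind\<^esub> \<in> carrier Ind"
  by (auto simp: Ind_zero carrier_Ind)

lemma ind_fun_zero: "g \<in> carrier G \<Longrightarrow> ind_fun \<zero>\<^bsub>Ind\<^esub> g = 0"
  by (simp add: Ind_zero ind_fun_coset)

context
  fixes f :: "('g \<Rightarrow> 'f) \<Rightarrow> 'g \<Rightarrow> 'f" and c :: 'f and t :: "'g \<Rightarrow> 'g"
  assumes f_in: "\<And>a. a \<in> carrier FG \<Longrightarrow> f a \<in> carrier FG"
    and t_in: "\<And>g. g \<in> carrier G \<Longrightarrow> t g \<in> carrier G"
    and f_eval: "\<And>a d g. a \<in> carrier FG \<Longrightarrow> g \<in> carrier G \<Longrightarrow> ind_eval g (f a, d) = c * ind_eval (t g) (a, d)"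
begin

lemma frag_eval_lift:
  assumes "Poly_Mapping.keys x \<subseteq> carrier FG \<times> UNIV" "g \<in> carrier G"
  shows "frag_eval (ind_eval g) (frag_extend (\<lambda>(m, n). frag_of (f m, n)) x) = c * frag_eval (ind_eval (t g)) x"
  by (rule frag_eval_extend[OF assms(1)]) (use assms(2) f_eval in auto)

lemma keys_lift:
  assumes "Poly_Mapping.keys x \<subseteq> carrier FG \<times> UNIV"
  shows "Poly_Mapping.keys (frag_extend (\<lambda>(m, n). frag_of (f m, n)) x) \<subseteq> carrier FG \<times> UNIV"
  using keys_frag_extend[of "\<lambda>(m, n). frag_of (f m, n)" x] assms f_in by fastforce

text \<open>By \<open>ind_rel_iff\<close>, relations are recognized by their evaluations, and
  \<open>f\<close> only rescales these and moves the point; so \<open>f\<close> preserves relations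
  and the union in \<open>tensor_map_left\<close> collapses to one coset. The instances are scalars,
  with \<open>t\<close> the identity, and translation by \<open>h\<close>, with \<open>c = 1\<close>
  and \<open>t g = inv h \<otimes> g\<close>.\<close>

lemma ind_lift_coset:
  assumes x: "Poly_Mapping.keys x \<subseteq> carrier FG \<times> UNIV"
  shows "ind_lift f (ind_coset x) = ind_coset (frag_extend (\<lambda>(m, n). frag_of (f m, n)) x)"
proof -
  let ?e = "frag_extend (\<lambda>(m, n). frag_of (f m, n))"
  have "ind_coset (?e y) = ind_coset (?e x)" if y: "y \<in> ind_coset x" for y
  proof (rule ind_coset_eqI)
    obtain r where r: "r \<in> ind_rel" "y = r + x" using y unfolding ind_coset_eq by blast
    then have "?e y - ?e x = ?e r" by (simp add: frag_extend_add)
    then show "?e y - ?e x \<in> ind_rel"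
      using r(1) keys_lift[of r] frag_eval_lift[of r] t_in by (simp add: ind_rel_iff)
  qed
  then have "(\<Union>y\<in>ind_coset x. ind_coset (?e y)) = ind_coset (?e x)"
    using ind_coset_self[of x] by blast
  then show ?thesis
    by (simp add: Ind_map_def tensor_map_left_def ind_coset_def)
qed

lemma ind_lift_in: "w \<in> carrier Ind \<Longrightarrow> ind_lift f w \<in> carrier Ind"
  by (elim Ind_cases) (auto simp: ind_lift_coset carrier_Ind intro!: imageI dest: keys_lift)

lemma ind_fun_lift: "w \<in> carrier Ind \<Longrightarrow> g \<in> carrier G \<Longrightarrow> ind_fun (ind_lift f w) g = c * ind_fun w (t g)"
  by (elim Ind_cases) (simp add: ind_lift_coset ind_fun_coset frag_eval_lift t_in)

end

lemma scale_lift: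
  "a \<in> carrier FG \<Longrightarrow> c \<odot>\<^bsub>FG\<^esub> a \<in> carrier FG"
  "g \<in> carrier G \<Longrightarrow> ind_eval g (c \<odot>\<^bsub>FG\<^esub> a, d) = c * ind_eval g (a, d)"
  using U_sub by (auto simp: group_algebra_def ind_eval_def sum_distrib_left mult_ac intro!: sum.cong)

lemma Ind_smult: "c \<odot>\<^bsub>Ind\<^esub> w = ind_lift (\<lambda>a. c \<odot>\<^bsub>FG\<^esub> a) w"
  by (simp add: Ind_space_def)

lemma Ind_smult_closed: "w \<in> carrier Ind \<Longrightarrow> c \<odot>\<^bsub>Ind\<^esub> w \<in> carrier Ind"
  unfolding Ind_smult by (rule ind_lift_in[where c = c and t = "\<lambda>g. g"]) (simp_all add: scale_lift)

lemma ind_fun_smult: "w \<in> carrier Ind \<Longrightarrow> g \<in> carrier G \<Longrightarrow> ind_fun (c \<odot>\<^bsub>Ind\<^esub> w) g = c * ind_fun w g"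
  unfolding Ind_smult by (rule ind_fun_lift[where c = c and t = "\<lambda>g. g"]) (simp_all add: scale_lift)

lemma translate_apply:
  assumes "h \<in> carrier G" "x \<in> carrier G"
  shows "(group_algebra_of class_ring G h \<otimes>\<^bsub>FG\<^esub> a) x = a (inv h \<otimes> x)"
proof -
  have "(group_algebra_of class_ring G h \<otimes>\<^bsub>FG\<^esub> a) x = (\<Sum>y\<in>carrier G. if y = h then a (inv y \<otimes> x) else 0)"
    using assms(2) by (auto simp: group_algebra_def group_algebra_of_def class_ring_simps intro!: sum.cong)
  also have "\<dots> = a (inv h \<otimes> x)"
    using sum.delta[OF finite_G, of h "\<lambda>y. a (inv y \<otimes> x)"] assms(1) by simp
  finally show ?thesis .
qed

lemma translate_lift:
  assumes "h \<in> carrier G"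
  shows "group_algebra_of class_ring G h \<otimes>\<^bsub>FG\<^esub> a \<in> carrier FG"
    and "g \<in> carrier G \<Longrightarrow> ind_eval g (group_algebra_of class_ring G h \<otimes>\<^bsub>FG\<^esub> a, d) = ind_eval (inv h \<otimes> g) (a, d)"
proof -
  show "group_algebra_of class_ring G h \<otimes>\<^bsub>FG\<^esub> a \<in> carrier FG"
    by (simp add: group_algebra_def)
  assume "g \<in> carrier G"
  then show "ind_eval g (group_algebra_of class_ring G h \<otimes>\<^bsub>FG\<^esub> a, d) = ind_eval (inv h \<otimes> g) (a, d)"
    using assms by (simp add: ind_eval_def translate_apply U_sub m_assoc)
qed

lemma ind_act_closed: "h \<in> carrier G \<Longrightarrow> w \<in> carrier Ind \<Longrightarrow> ind_act h w \<in> carrier Ind"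
  unfolding Ind_action_def
  by (rule ind_lift_in[where c = 1 and t = "\<lambda>g. inv h \<otimes> g"]) (simp_all add: translate_lift)

lemma ind_fun_act: "h \<in> carrier G \<Longrightarrow> w \<in> carrier Ind \<Longrightarrow> g \<in> carrier G \<Longrightarrow>
    ind_fun (ind_act h w) g = ind_fun w (inv h \<otimes> g)"
  unfolding Ind_action_def
  by (subst ind_fun_lift[where c = 1 and t = "\<lambda>g. inv h \<otimes> g"]) (simp_all add: translate_lift)

text \<open>The embedding lands in \<open>F[G] e\<close>, whose elements are right equivariant.
  Evaluated at the identity, this becomes the Whittaker property.\<close>

lemma ind_eval_right:
  assumes "u \<in> U" "g \<in> carrier G"
  shows "ind_eval (g \<otimes> u) s = \<theta> (inv u) * ind_eval g s"
proof -
  obtain a c where s: "s = (a, c)" by (cases s)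
  have "(\<Sum>w\<in>U. a (g \<otimes> u \<otimes> w) * \<theta> w) = (\<Sum>w\<in>U. a (g \<otimes> (u \<otimes> w)) * (\<theta> (inv u) * \<theta> (u \<otimes> w)))"
  proof (rule sum.cong)
    fix w assume w: "w \<in> U"
    have "\<theta> (inv u) * \<theta> (u \<otimes> w) = \<theta> w"
      using assms w by (simp add: theta_mult theta_inv mult.assoc[symmetric])
    then show "a (g \<otimes> u \<otimes> w) * \<theta> w = a (g \<otimes> (u \<otimes> w)) * (\<theta> (inv u) * \<theta> (u \<otimes> w))"
      using assms w by (simp add: m_assoc U_sub)
  qed simp
  also have "\<dots> = (\<Sum>w\<in>U. a (g \<otimes> w) * (\<theta> (inv u) * \<theta> w))"
    by (rule sum_U_translate(1)[OF assms(1), of "\<lambda>w. a (g \<otimes> w) * (\<theta> (inv u) * \<theta> w)"])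
  also have "\<dots> = \<theta> (inv u) * (\<Sum>w\<in>U. a (g \<otimes> w) * \<theta> w)"
    by (simp add: sum_distrib_left mult.left_commute)
  finally show ?thesis
    by (simp add: ind_eval_def s mult.left_commute)
qed

lemma ind_fun_right:
  assumes w: "w \<in> carrier Ind" and u: "u \<in> U" and g: "g \<in> carrier G"
  shows "ind_fun w (g \<otimes> u) = \<theta> (inv u) * ind_fun w g"
proof -
  obtain x where "w = ind_coset x" using w by (rule Ind_cases)
  then show ?thesis
    using u g U_sub by (simp add: ind_fun_coset frag_eval_def ind_eval_right sum_distrib_left mult.left_commute)
qed

text \<open>The axioms are pulled back from functions on \<open>G\<close> along the injective map
  \<open>ind_fun\<close>.\<close>

lemma vectorspace_Ind: "vectorspace class_ring Ind"
proof -
  note simps = ind_fun_add ind_fun_zero ind_fun_smult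
  note closed = Ind_add_closed Ind_zero_closed Ind_smult_closed
  have "abelian_group Ind"
  proof (rule abelian_groupI)
    fix x assume x: "x \<in> carrier Ind"
    have "(- 1) \<odot>\<^bsub>Ind\<^esub> x \<oplus>\<^bsub>Ind\<^esub> x = \<zero>\<^bsub>Ind\<^esub>"
      by (rule Ind_eqI) (simp_all add: x simps closed)
    then show "\<exists>y\<in>carrier Ind. y \<oplus>\<^bsub>Ind\<^esub> x = \<zero>\<^bsub>Ind\<^esub>"
      using x closed by blast
  qed ((rule Ind_eqI, simp_all add: simps closed add_ac)[1] | simp add: closed)+
  then have "Module.module class_ring Ind"
    by (intro moduleI class_cring.is_cring)
       ((rule Ind_eqI, simp_all add: simps closed algebra_simps)[1] | simp add: closed)+
  then show ?thesis by (simp add: vectorspace_def class_field)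
qed

end

section \<open>Homomorphism spaces and Frobenius reciprocity\<close>

lemma vectorspace_rep_Hom:
  assumes "group_representation G F V \<rho>" "group_representation G F W \<sigma>"
  shows "vectorspace F (rep_Hom G F V \<rho> W \<sigma>)"
proof -
  interpret V: group_representation G F V \<rho> by fact
  interpret W: group_representation G F W \<sigma> by fact
  let ?H = "rep_Hom G F V \<rho> W \<sigma>"
  have W_closed: "\<sigma> g w \<in> carrier W" if "g \<in> carrier G" "w \<in> carrier W" for g w
    using W.linear[OF that(1)] that(2) by (auto simp: module_hom_def)
  have W_add: "\<sigma> g (w \<oplus>\<^bsub>W\<^esub> w') = \<sigma> g w \<oplus>\<^bsub>W\<^esub> \<sigma> g w'"
    if "g \<in> carrier G" "w \<in> carrier W" "w' \<in> carrier W" for g w w'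
    using W.linear[OF that(1)] that by (auto simp: module_hom_def)
  have W_smult: "\<sigma> g (c \<odot>\<^bsub>W\<^esub> w) = c \<odot>\<^bsub>W\<^esub> \<sigma> g w"
    if "g \<in> carrier G" "c \<in> carrier F" "w \<in> carrier W" for g w c
    using W.linear[OF that(1)] that by (auto simp: module_hom_def)
  have V_closed: "\<rho> g v \<in> carrier V" if "g \<in> carrier G" "v \<in> carrier V" for g v
    using V.linear[OF that(1)] that(2) by (auto simp: module_hom_def)
  have mem: "f \<in> carrier ?H \<longleftrightarrow> f \<in> extensional (carrier V) \<and> (\<forall>v\<in>carrier V. f v \<in> carrier W) \<and>
      (\<forall>v\<in>carrier V. \<forall>w\<in>carrier V. f (v \<oplus>\<^bsub>V\<^esub> w) = f v \<oplus>\<^bsub>W\<^esub> f w) \<and>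
      (\<forall>c\<in>carrier F. \<forall>v\<in>carrier V. f (c \<odot>\<^bsub>V\<^esub> v) = c \<odot>\<^bsub>W\<^esub> f v) \<and>
      (\<forall>g\<in>carrier G. \<forall>v\<in>carrier V. f (\<rho> g v) = \<sigma> g (f v))" for f
    by (auto simp: rep_Hom_def module_hom_def)
  have ops: "\<zero>\<^bsub>?H\<^esub> = (\<lambda>v\<in>carrier V. \<zero>\<^bsub>W\<^esub>)"
      "f \<oplus>\<^bsub>?H\<^esub> h = (\<lambda>v\<in>carrier V. f v \<oplus>\<^bsub>W\<^esub> h v)" "c \<odot>\<^bsub>?H\<^esub> f = (\<lambda>v\<in>carrier V. c \<odot>\<^bsub>W\<^esub> f v)" for f h c
    by (simp_all add: rep_Hom_def)
  have eqI: "f = h" if "f \<in> carrier ?H" "h \<in> carrier ?H" "\<And>v. v \<in> carrier V \<Longrightarrow> f v = h v" for f h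
    using that unfolding mem by (auto intro!: extensionalityI[of _ "carrier V"])
  have sigma_zero: "\<sigma> g \<zero>\<^bsub>W\<^esub> = \<zero>\<^bsub>W\<^esub>" if "g \<in> carrier G" for g
    using W_smult[OF that V.V.R.zero_closed W.V.zero_closed] W_closed[OF that W.V.zero_closed]
    by simp
  have zero_closed: "\<zero>\<^bsub>?H\<^esub> \<in> carrier ?H"
    by (simp add: mem ops sigma_zero V_closed)
  have add_closed: "f \<oplus>\<^bsub>?H\<^esub> h \<in> carrier ?H" if "f \<in> carrier ?H" "h \<in> carrier ?H" for f h
    using that unfolding mem ops
    by (auto simp: V_closed W_closed W_add W_smult W.V.add.m_ac W.V.smult_r_distr)
  have smult_closed: "c \<odot>\<^bsub>?H\<^esub> f \<in> carrier ?H" if "c \<in> carrier F" "f \<in> carrier ?H" for c f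
    using that unfolding mem ops
    by (auto simp: V_closed W_closed W_add W_smult W.V.smult_r_distr W.V.smult_assoc1[symmetric] V.V.R.m_comm)
  have apply_closed: "f v \<in> carrier W" if "f \<in> carrier ?H" "v \<in> carrier V" for f v
    using that unfolding mem by blast
  have "abelian_group ?H"
  proof (rule abelian_groupI)
    fix f assume f: "f \<in> carrier ?H"
    have "(\<ominus>\<^bsub>F\<^esub> \<one>\<^bsub>F\<^esub>) \<odot>\<^bsub>?H\<^esub> f \<oplus>\<^bsub>?H\<^esub> f = \<zero>\<^bsub>?H\<^esub>"
      by (rule eqI) (simp_all add: f add_closed smult_closed zero_closed,
          simp add: ops apply_closed f W.V.smult_minus_1 W.V.l_neg)
    then show "\<exists>h\<in>carrier ?H. h \<oplus>\<^bsub>?H\<^esub> f = \<zero>\<^bsub>?H\<^esub>"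
      using smult_closed f by blast
  next
    show "f \<oplus>\<^bsub>?H\<^esub> g \<oplus>\<^bsub>?H\<^esub> h = f \<oplus>\<^bsub>?H\<^esub> (g \<oplus>\<^bsub>?H\<^esub> h)" if "f \<in> carrier ?H" "g \<in> carrier ?H" "h \<in> carrier ?H" for f g h
      by (rule eqI) (simp_all add: that add_closed, simp add: that ops apply_closed W.V.add.m_assoc)
    show "f \<oplus>\<^bsub>?H\<^esub> g = g \<oplus>\<^bsub>?H\<^esub> f" if "f \<in> carrier ?H" "g \<in> carrier ?H" for f g
      by (rule eqI) (simp_all add: that add_closed, simp add: that ops apply_closed W.V.add.m_comm)
    show "\<zero>\<^bsub>?H\<^esub> \<oplus>\<^bsub>?H\<^esub> f = f" if "f \<in> carrier ?H" for f
      by (rule eqI) (simp_all add: that add_closed zero_closed, simp add: that ops apply_closed)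
  qed (simp_all add: zero_closed add_closed)
  then have "Module.module F ?H"
  proof (rule moduleI[OF V.V.R.is_cring])
    show "(a \<oplus>\<^bsub>F\<^esub> b) \<odot>\<^bsub>?H\<^esub> f = a \<odot>\<^bsub>?H\<^esub> f \<oplus>\<^bsub>?H\<^esub> b \<odot>\<^bsub>?H\<^esub> f"
      if "a \<in> carrier F" "b \<in> carrier F" "f \<in> carrier ?H" for a b f
      by (rule eqI) (simp_all add: that add_closed smult_closed, simp add: that ops apply_closed W.V.smult_l_distr)
    show "a \<odot>\<^bsub>?H\<^esub> (f \<oplus>\<^bsub>?H\<^esub> h) = a \<odot>\<^bsub>?H\<^esub> f \<oplus>\<^bsub>?H\<^esub> a \<odot>\<^bsub>?H\<^esub> h"
      if "a \<in> carrier F" "f \<in> carrier ?H" "h \<in> carrier ?H" for a f h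
      by (rule eqI) (simp_all add: that add_closed smult_closed, simp add: that ops apply_closed W.V.smult_r_distr)
    show "(a \<otimes>\<^bsub>F\<^esub> b) \<odot>\<^bsub>?H\<^esub> f = a \<odot>\<^bsub>?H\<^esub> (b \<odot>\<^bsub>?H\<^esub> f)"
      if "a \<in> carrier F" "b \<in> carrier F" "f \<in> carrier ?H" for a b f
      by (rule eqI) (simp_all add: that smult_closed, simp add: that ops apply_closed W.V.smult_assoc1)
    show "\<one>\<^bsub>F\<^esub> \<odot>\<^bsub>?H\<^esub> f = f" if "f \<in> carrier ?H" for f
      by (rule eqI) (simp_all add: that smult_closed, simp add: that ops apply_closed)
  qed (simp_all add: smult_closed)
  then show ?thesis
    using V.V.field_axioms by (simp add: vectorspace_def)
qed

text \<open>The vector \<open>f0\<close> may be zero, so that the zero space is covered as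
  well.\<close>

lemma (in vectorspace) fin_dim_le_1I:
  assumes "f0 \<in> carrier V" "\<And>f. f \<in> carrier V \<Longrightarrow> \<exists>c\<in>carrier K. f = c \<odot>\<^bsub>V\<^esub> f0"
  shows "fin_dim \<and> dim \<le> 1"
proof -
  have f0: "{f0} \<subseteq> carrier V" using assms(1) by blast
  interpret S: submodule K "span {f0}" V by (rule span_is_submodule[OF f0])
  have "f0 \<in> span {f0}" using in_own_span[OF f0] by blast
  then have "carrier V \<subseteq> span {f0}" using assms(2) S.smult_closed by blast
  then have gen: "gen_set {f0}" using span_is_subset2[OF f0] by (rule equalityI[rotated])
  then have "fin_dim" unfolding fin_dim_def using f0 by (intro exI[of _ "{f0}"] conjI) simp_all
  then show ?thesis using dim_le1I[OF gen assms(1)] by (rule conjI)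
qed

context multiplicative_character
begin

lemma group_representation_Ind: "group_representation G class_ring Ind ind_act"
proof -
  note simps = ind_fun_add ind_fun_smult ind_fun_act
  note closed = Ind_add_closed Ind_smult_closed ind_act_closed
  have "ind_act g \<in> module_hom class_ring Ind Ind" if g: "g \<in> carrier G" for g
    unfolding module_hom_def
    by (intro CollectI conjI allI impI; (elim conjE, rule Ind_eqI)?) (simp_all add: g simps closed Pi_iff)
  moreover have "ind_act \<one> w = w" if "w \<in> carrier Ind" for w
    by (rule Ind_eqI) (simp_all add: that closed simps)
  moreover have "ind_act (g \<otimes> h) w = ind_act g (ind_act h w)"
    if "g \<in> carrier G" "h \<in> carrier G" "w \<in> carrier Ind" for g h w
    by (rule Ind_eqI) (simp_all add: that closed simps inv_mult_group m_assoc)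
  ultimately show ?thesis
    using vectorspace_Ind is_group
    by (simp add: group_representation_def group_representation_axioms_def)
qed

lemma group_representation_line:
  "group_representation (G\<lparr>carrier := U\<rparr>) class_ring char_line (character_action class_ring \<theta>)"
  using subgroup.subgroup_is_group[OF subgroup_U is_group] vectorspace_line
  by (simp add: group_representation_def group_representation_axioms_def module_hom_def
      character_action_def theta_one theta_mult algebra_simps)

end

context irreducible_with_character
begin

text \<open>Frobenius reciprocity: evaluation at \<open>\<one>\<close> turns a homomorphism into a
  Whittaker functional, from which equivariance recovers all its values. Uniqueness of the
  functional up to scalars thus passes to homomorphisms.\<close>

lemma rep_Hom_Ind_dim_le_1:
  assumes comm: "\<And>a b x. hecke a \<Longrightarrow> hecke b \<Longrightarrow> x \<in> carrier G \<Longrightarrow> conv a b x = conv b a x"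
  shows "vectorspace.fin_dim class_ring (rep_Hom G class_ring V \<rho> Ind ind_act) \<and>
    vectorspace.dim class_ring (rep_Hom G class_ring V \<rho> Ind ind_act) \<le> 1"
proof -
  let ?H = "rep_Hom G class_ring V \<rho> Ind ind_act"
  interpret irreducible_representation G class_ring V \<rho> by (rule irr)
  interpret H: vectorspace class_ring ?H
    by (rule vectorspace_rep_Hom[OF _ group_representation_Ind]) unfold_locales
  define lam where "lam f v = ind_fun (f v) \<one>" for f :: "'v \<Rightarrow> (('g \<Rightarrow> 'f) \<times> 'f \<Rightarrow>\<^sub>0 int) set" and v
  have mem: "f \<in> extensional (carrier V)" "v \<in> carrier V \<Longrightarrow> f v \<in> carrier Ind"
      "v \<in> carrier V \<Longrightarrow> w \<in> carrier V \<Longrightarrow> f (v \<oplus>\<^bsub>V\<^esub> w) = f v \<oplus>\<^bsub>Ind\<^esub> f w"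
      "v \<in> carrier V \<Longrightarrow> f (c \<odot>\<^bsub>V\<^esub> v) = c \<odot>\<^bsub>Ind\<^esub> f v"
      "g \<in> carrier G \<Longrightarrow> v \<in> carrier V \<Longrightarrow> f (\<rho> g v) = ind_act g (f v)"
    if "f \<in> carrier ?H" for f v w c g
    using that by (auto simp: rep_Hom_def module_hom_def)
  have lam_wf: "whittaker_functional (lam f)" if f: "f \<in> carrier ?H" for f
  proof -
    \<comment> \<open>Acting by \<open>u\<close> moves the point of evaluation to
      \<open>inv u\<close>, and right equivariance turns this into the factor
      \<open>\<theta> u\<close>.\<close>
    have "lam f (\<rho> u v) = \<theta> u * lam f v" if "u \<in> U" "v \<in> carrier V" for u v
      using ind_fun_right[OF mem(2)[OF f that(2)] U_inv[OF that(1)] one_closed] that U_sub U_inv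
      by (simp add: lam_def mem(5)[OF f] mem(2)[OF f] ind_fun_act)
    then show ?thesis
      unfolding whittaker_functional_def
      by (simp add: lam_def mem(2,3,4)[OF f] ind_fun_add ind_fun_smult)
  qed
  have determined: "ind_fun (f v) g = lam f (\<rho> (inv g) v)"
    if "f \<in> carrier ?H" "v \<in> carrier V" "g \<in> carrier G" for f v g
    using that by (simp add: lam_def mem(5)[OF that(1)] mem(2)[OF that(1)] ind_fun_act)
  have smultI: "f = c \<odot>\<^bsub>?H\<^esub> f0"
    if f: "f \<in> carrier ?H" "f0 \<in> carrier ?H" and eq: "\<And>v. v \<in> carrier V \<Longrightarrow> lam f v = c * lam f0 v" for f f0 c
  proof (rule extensionalityI[of _ "carrier V"])
    fix v assume v: "v \<in> carrier V"
    have "f v = c \<odot>\<^bsub>Ind\<^esub> f0 v"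
    proof (rule Ind_eqI)
      fix g assume g: "g \<in> carrier G"
      then have "ind_fun (f v) g = c * ind_fun (f0 v) g"
        using determined[OF f(1) v g] determined[OF f(2) v g] eq[OF rho_in[OF inv_closed[OF g] v]] by simp
      then show "ind_fun (f v) g = ind_fun (c \<odot>\<^bsub>Ind\<^esub> f0 v) g"
        using g v by (simp add: mem(2)[OF f(2)] ind_fun_smult)
    qed (simp_all add: mem(2)[OF f(1)] mem(2)[OF f(2)] v Ind_smult_closed)
    then show "f v = (c \<odot>\<^bsub>?H\<^esub> f0) v" using v by (simp add: rep_Hom_def)
  qed (use mem(1)[OF f(1)] in \<open>simp_all add: rep_Hom_def\<close>)
  show ?thesis
  proof (cases "\<exists>f0\<in>carrier ?H. \<exists>v0\<in>carrier V. lam f0 v0 \<noteq> 0")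
    case True
    then obtain f0 v0 where f0: "f0 \<in> carrier ?H" and v0: "v0 \<in> carrier V" "lam f0 v0 \<noteq> 0" by blast
    show ?thesis
    proof (rule H.fin_dim_le_1I[OF f0])
      fix f assume f: "f \<in> carrier ?H"
      obtain c where "\<forall>v\<in>carrier V. lam f v = c * lam f0 v"
        using whittaker_functional_unique[OF comm lam_wf[OF f0] v0 lam_wf[OF f]] by blast
      then show "\<exists>c\<in>carrier class_ring. f = c \<odot>\<^bsub>?H\<^esub> f0"
        using smultI[OF f f0] by auto
    qed
  next
    case False
    show ?thesis
    proof (rule H.fin_dim_le_1I[OF H.M.zero_closed])
      fix f assume f: "f \<in> carrier ?H"
      \<comment> \<open>All functionals vanish here, so every homomorphism is zero.\<close>
      have "f = 0 \<odot>\<^bsub>?H\<^esub> \<zero>\<^bsub>?H\<^esub>"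
        by (rule smultI[OF f H.M.zero_closed]) (use False f in auto)
      then show "\<exists>c\<in>carrier class_ring. f = c \<odot>\<^bsub>?H\<^esub> \<zero>\<^bsub>?H\<^esub>" by auto
    qed
  qed
qed

end

section \<open>The order of the base field\<close>

lemma class_ring_pow: "x [^]\<^bsub>add_monoid (class_ring :: 'k :: field ring)\<^esub> (m :: nat) = of_nat m * x"
  by (induction m) (simp_all add: nat_pow_def algebra_simps)

text \<open>Sylow's theorem yields a subgroup of order \<open>p\<close> in the additive group, hence
  a nonzero \<open>x\<close> with \<open>p x = 0\<close>; in a field \<open>x\<close>
  cancels.\<close>

lemma of_nat_zero_if_prime_dvd_card:
  assumes "prime p" "p dvd CARD('k :: {field, finite})"
  shows "of_nat p = (0 :: 'k)"
proof -
  let ?A = "add_monoid (class_ring :: 'k ring)"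
  interpret A: group ?A
    using abelian_group.a_group[OF ring.is_abelian_group[OF cring.axioms(1)[OF class_cring.is_cring]]] .
  obtain m where "CARD('k) = p ^ 1 * m" using assms(2) by auto
  then have "Coset.order ?A = p ^ 1 * m" by (simp add: Coset.order_def)
  from sylow_thm[OF assms(1) A.is_group this] obtain H where H: "subgroup H ?A" "card H = p ^ 1"
    by auto
  have "finite H" by simp
  have "card H > 1" using H(2) prime_gt_1_nat[OF assms(1)] by simp
  then obtain x where x: "x \<in> H" "x \<noteq> 0"
    using card_mono[of "{0}" H] by fastforce
  interpret H: group "?A\<lparr>carrier := H\<rparr>" by (rule subgroup.subgroup_is_group[OF H(1) A.is_group])
  have "x [^]\<^bsub>?A\<lparr>carrier := H\<rparr>\<^esub> card H = 0"
    using H.pow_order_eq_1[of x] x(1) by (simp add: Coset.order_def)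
  then have "of_nat p * x = 0"
    using class_ring_pow[of x "card H"] H(2) by (simp add: nat_pow_def)
  then show ?thesis using x(2) by simp
qed

text \<open>If the characteristic \<open>p\<close> of \<open>'f\<close> divided the order of
  \<open>'k\<close>, then \<open>p = 0\<close> in \<open>'k\<close> too, so
  \<open>\<psi> x ^ p = 1\<close>. In characteristic \<open>p\<close> this reads
  \<open>(\<psi> x - 1) ^ p = 0\<close>, which forces \<open>\<psi> x = 1\<close>.\<close>

lemma nontrivial_character_card_nonzero:
  fixes \<psi> :: "'k :: {field, finite} \<Rightarrow> 'f :: field"
  assumes "nontrivial_character class_ring \<psi>"
  shows "of_nat CARD('k) \<noteq> (0 :: 'f)"
proof
  assume "of_nat CARD('k) = (0 :: 'f)"
  then have dvd: "CHAR('f) dvd CARD('k)" by (simp add: of_nat_eq_0_iff_char_dvd)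
  have "CARD('k) > 0" by simp
  with dvd have "CHAR('f) > 0" by (metis dvd_0_left_iff gr0I less_irrefl)
  then have p: "prime CHAR('f)" by (rule prime_CHAR_semidom)
  have add: "\<psi> (x + y) = \<psi> x * \<psi> y" for x y
    using assms by (auto simp: nontrivial_character_def hom_def units_of_def)
  obtain x where x: "\<psi> x \<noteq> 1"
    using assms by (auto simp: nontrivial_character_def)
  have "\<exists>y. y * \<psi> 0 = 1"
    using assms by (auto simp: nontrivial_character_def hom_def units_of_def Units_def Pi_iff)
  then have "\<psi> 0 \<noteq> 0" by auto
  then have zero: "\<psi> 0 = 1" using add[of 0 0] by simp
  have "\<psi> (of_nat m * x) = \<psi> x ^ m" for m
    by (induction m) (simp_all add: zero add algebra_simps)
  from this[of "CHAR('f)"] have "\<psi> x ^ CHAR('f) = 1"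
    using of_nat_zero_if_prime_dvd_card[OF p dvd] by (simp add: zero)
  then have "((\<psi> x - 1) + 1) ^ CHAR('f) = 1" by simp
  then have "(\<psi> x - 1) ^ CHAR('f) + 1 = 1"
    using freshmans_dream[OF p refl, of "\<psi> x - 1" 1] by simp
  then show False using x by simp
qed

section \<open>The general linear group\<close>

lemma carrier_GL: "A \<in> carrier (GL n :: 'k :: field mat monoid) \<longleftrightarrow> A \<in> carrier_mat n n \<and> det A \<noteq> 0"
proof
  assume "A \<in> carrier (GL n)"
  then have "A \<in> Units (ring_mat TYPE('k) n ())" by (simp add: GL_def units_of_def)
  then show "A \<in> carrier_mat n n \<and> det A \<noteq> 0"
    using unit_imp_det_non_zero monoid.Units_closed[OF ring.is_monoid[OF ring_mat]]
    by (metis ring_mat_simps(5))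
next
  assume "A \<in> carrier_mat n n \<and> det A \<noteq> 0"
  then show "A \<in> carrier (GL n)"
    using det_non_zero_imp_unit[of A n "()"] by (simp add: GL_def units_of_def)
qed

lemma GL_mult [simp]: "A \<otimes>\<^bsub>GL n\<^esub> B = A * (B :: 'k :: field mat)"
  and GL_one [simp]: "\<one>\<^bsub>GL n\<^esub> = (1\<^sub>m n :: 'k :: field mat)"
  by (simp_all add: GL_def units_of_def ring_mat_simps)

lemma group_GL: "group (GL n :: 'k :: field mat monoid)"
  unfolding GL_def by (rule monoid.units_group[OF ring.is_monoid[OF ring_mat]])

lemma finite_carrier_mat: "finite (carrier_mat n m :: 'k :: finite mat set)"
proof -
  have "carrier_mat n m \<subseteq> (mat n m :: _ \<Rightarrow> 'k mat) ` (({..<n} \<times> {..<m}) \<rightarrow>\<^sub>E UNIV)"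
  proof
    fix A :: "'k mat" assume "A \<in> carrier_mat n m"
    then have "A = mat n m (restrict (\<lambda>ij. A $$ ij) ({..<n} \<times> {..<m}))"
      by (intro eq_matI) auto
    then show "A \<in> mat n m ` (({..<n} \<times> {..<m}) \<rightarrow>\<^sub>E UNIV)"
      by (rule image_eqI[where f = "mat n m"]) (simp add: PiE_def)
  qed
  then show ?thesis
    by (rule finite_subset) (intro finite_imageI finite_PiE finite_cartesian_product finite_lessThan finite_class.finite)
qed

lemma finite_GL: "finite (carrier (GL n :: 'k :: {field, finite} mat monoid))"
  by (rule finite_subset[OF _ finite_carrier_mat[of n n]]) (auto simp: carrier_GL)

lemma unitriangular_iff:
  "A \<in> unitriangular n \<longleftrightarrow> A \<in> carrier_mat n n \<and> (\<forall>i<n. A $$ (i, i) = 1) \<and> (\<forall>i<n. \<forall>j<i. A $$ (i, j) = 0)"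
  for A :: "'k :: field mat"
proof -
  have "det A \<noteq> 0" if A: "A \<in> carrier_mat n n" and "upper_triangular A" and "\<forall>i<n. A $$ (i, i) = 1"
  proof -
    have "diag_mat A = map (\<lambda>_. 1) [0..<n]"
      using A that(3) unfolding diag_mat_def by (intro map_cong) auto
    then have "det A = 1"
      using det_upper_triangular[OF that(2) A] by (simp add: map_replicate_const)
    then show ?thesis by simp
  qed
  then have "A \<in> carrier (GL n) \<longleftrightarrow> A \<in> carrier_mat n n"
    if "upper_triangular A" "\<forall>i<n. A $$ (i, i) = 1"
    using that unfolding carrier_GL by blast
  moreover have "upper_triangular A \<longleftrightarrow> (\<forall>i<n. \<forall>j<i. A $$ (i, j) = 0)" if "A \<in> carrier_mat n n"
    using that by (simp add: upper_triangular_def)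
  ultimately show ?thesis
    unfolding unitriangular_def mem_Collect_eq carrier_GL by blast
qed

lemma mat_mult_index:
  "A \<in> carrier_mat n n \<Longrightarrow> B \<in> carrier_mat n n \<Longrightarrow> i < n \<Longrightarrow> j < n \<Longrightarrow>
   (A * B) $$ (i, j) = (\<Sum>k<n. A $$ (i, k) * B $$ (k, j))"
  by (simp add: scalar_prod_def atLeast0LessThan)

text \<open>Only indices between \<open>i\<close> and \<open>j\<close> contribute to the product. Up
  to the superdiagonal these are at most two, so superdiagonal entries add; this is what makes
  \<open>eta\<close> multiplicative.\<close>

lemma unitriangular_mult_index:
  assumes A: "A \<in> unitriangular n" and B: "B \<in> unitriangular n" and ij: "i < n" "j < n" "j \<le> Suc i"
  shows "(A * B) $$ (i, j) = (if j < i then 0 else if j = i then 1 else A $$ (i, j) + B $$ (i, j))"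
proof -
  have c: "A \<in> carrier_mat n n" "B \<in> carrier_mat n n" using A B by (auto simp: unitriangular_iff)
  have "(A * B) $$ (i, j) = (\<Sum>k<n. A $$ (i, k) * B $$ (k, j))"
    by (rule mat_mult_index[OF c ij(1,2)])
  also have "\<dots> = (\<Sum>k\<in>{i..j}. A $$ (i, k) * B $$ (k, j))"
    by (rule sum.mono_neutral_right) (use A B ij in \<open>auto simp: unitriangular_iff not_le\<close>)
  also have "\<dots> = (if j < i then 0 else if j = i then 1 else A $$ (i, j) + B $$ (i, j))"
  proof -
    consider "j < i" | "j = i" | "j = Suc i" using ij(3) by linarith
    then show ?thesis
      by cases (use A B ij in \<open>auto simp: unitriangular_iff\<close>)
  qed
  finally show ?thesis .
qed

lemma unitriangular_mult: "A \<in> unitriangular n \<Longrightarrow> B \<in> unitriangular n \<Longrightarrow> A * B \<in> unitriangular n"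
proof -
  assume AB: "A \<in> unitriangular n" "B \<in> unitriangular n"
  then have "A * B \<in> carrier_mat n n" by (auto simp: unitriangular_iff)
  moreover have "(A * B) $$ (i, i) = 1" if "i < n" for i
    using unitriangular_mult_index[OF AB that that] by (simp del: index_mult_mat)
  moreover have "(A * B) $$ (i, j) = 0" if "i < n" "j < i" for i j
    using unitriangular_mult_index[OF AB that(1), of j] that by (simp del: index_mult_mat)
  ultimately show ?thesis unfolding unitriangular_iff by blast
qed

lemma unitriangular_one: "1\<^sub>m n \<in> unitriangular n"
  by (auto simp: unitriangular_iff)

lemma unitriangular_GL: "A \<in> unitriangular n \<Longrightarrow> A \<in> carrier (GL n)"
  by (simp add: unitriangular_def)

text \<open>Left translation by \<open>x\<close> is injective on the finite set \<open>H\<close>,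
  hence onto, and so reaches \<open>\<one>\<close>. For unitriangular matrices this spares a
  computation of inverses.\<close>

lemma (in group) finite_submonoid_subgroup:
  assumes "finite H" "H \<subseteq> carrier G" "\<one> \<in> H" "\<And>x y. x \<in> H \<Longrightarrow> y \<in> H \<Longrightarrow> x \<otimes> y \<in> H"
  shows "subgroup H G"
proof (rule subgroupI)
  fix x assume x: "x \<in> H"
  have "inj_on (\<lambda>y. x \<otimes> y) H"
    using x assms(2) by (intro inj_onI) (auto simp: subset_iff)
  then have "(\<lambda>y. x \<otimes> y) ` H = H"
    by (rule endo_inj_surj[OF assms(1), rotated]) (use x assms(4) in blast)
  then obtain y where "y \<in> H" "x \<otimes> y = \<one>" using assms(3) by (metis imageE)
  then have "inv x = y"
    using x assms(2) by (metis inv_comm inv_equality subsetD)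
  then show "inv x \<in> H" using \<open>y \<in> H\<close> by simp
qed (use assms in auto)

lemma subgroup_unitriangular: "subgroup (unitriangular n) (GL n :: 'k :: {field, finite} mat monoid)"
  by (rule group.finite_submonoid_subgroup[OF group_GL])
     (auto intro: finite_subset[OF _ finite_GL] unitriangular_GL unitriangular_one unitriangular_mult)

text \<open>The entries above the diagonal are free. What counts later is that the order is a power
  of \<open>CARD('k)\<close>, hence nonzero in the coefficient field.\<close>

lemma card_unitriangular:
  "card (unitriangular n :: 'k :: {field, finite} mat set) = CARD('k) ^ card {(i, j). i < j \<and> j < n}"
proof -
  let ?S = "{(i, j). i < j \<and> j < n}"
  have fin: "finite ?S" by (rule finite_subset[of _ "{..<n} \<times> {..<n}"]) auto
  define F where "F f = mat n n (\<lambda>(i, j). if i < j then f (i, j) else if i = j then 1 else 0 :: 'k)"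
    for f :: "nat \<times> nat \<Rightarrow> 'k"
  have "bij_betw F (?S \<rightarrow>\<^sub>E UNIV) (unitriangular n)"
  proof (rule bij_betwI[where g = "\<lambda>A. restrict (\<lambda>ij. A $$ ij) ?S"])
    show "restrict (\<lambda>ij. F f $$ ij) ?S = f" if "f \<in> ?S \<rightarrow>\<^sub>E UNIV" for f
      using that by (intro extensionalityI[of _ ?S]) (auto simp: F_def PiE_def)
    show "F (restrict (\<lambda>ij. A $$ ij) ?S) = A" if "A \<in> unitriangular n" for A
      using that by (intro eq_matI) (auto simp: F_def unitriangular_iff)
  qed (auto simp: F_def unitriangular_iff)
  then have "card (unitriangular n :: 'k mat set) = card (?S \<rightarrow>\<^sub>E (UNIV :: 'k set))"
    by (rule bij_betw_same_card[symmetric])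
  then show ?thesis by (simp add: card_PiE[OF fin])
qed

section \<open>The reflection in the antidiagonal\<close>

definition antitranspose :: "nat \<Rightarrow> 'a mat \<Rightarrow> 'a mat"
  where "antitranspose n A = mat n n (\<lambda>(i, j). A $$ (n - 1 - j, n - 1 - i))"

lemma antitranspose_carrier [simp]: "antitranspose n A \<in> carrier_mat n n"
  by (simp add: antitranspose_def)

lemma antitranspose_index: "i < n \<Longrightarrow> j < n \<Longrightarrow> antitranspose n A $$ (i, j) = A $$ (n - 1 - j, n - 1 - i)"
  by (simp add: antitranspose_def)

lemma antitranspose_antitranspose: "A \<in> carrier_mat n n \<Longrightarrow> antitranspose n (antitranspose n A) = A"
  by (intro eq_matI) (auto simp: antitranspose_def)

text \<open>The map is the transpose followed by conjugation with the reversal permutation, so it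
  inherits the reversal of products; in coordinates this is the substitution
  \<open>k \<mapsto> n - 1 - k\<close>.\<close>

lemma antitranspose_mult:
  assumes "A \<in> carrier_mat n n" "B \<in> carrier_mat n n"
  shows "antitranspose n (A * B) = antitranspose n B * antitranspose n (A :: 'k :: comm_semiring_0 mat)"
proof (rule eq_matI)
  fix i j assume "i < dim_row (antitranspose n B * antitranspose n A)" "j < dim_col (antitranspose n B * antitranspose n A)"
  then have ij: "i < n" "j < n" by (auto simp: antitranspose_def)
  have "antitranspose n (A * B) $$ (i, j) = (\<Sum>k<n. A $$ (n - 1 - j, k) * B $$ (k, n - 1 - i))"
    unfolding antitranspose_index[OF ij] using ij assms by (intro mat_mult_index) auto
  also have "\<dots> = (\<Sum>k<n. A $$ (n - 1 - j, n - 1 - k) * B $$ (n - 1 - k, n - 1 - i))"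
    by (rule sum.reindex_bij_witness[of _ "\<lambda>k. n - 1 - k" "\<lambda>k. n - 1 - k"]) auto
  also have "\<dots> = (antitranspose n B * antitranspose n A) $$ (i, j)"
    using ij by (subst mat_mult_index) (auto simp: antitranspose_index mult.commute intro!: sum.cong)
  finally show "antitranspose n (A * B) $$ (i, j) = (antitranspose n B * antitranspose n A) $$ (i, j)" .
qed (auto simp: antitranspose_def)

lemma antitranspose_one: "antitranspose n (1\<^sub>m n) = 1\<^sub>m n"
  by (intro eq_matI) (auto simp: antitranspose_def)

lemma antitranspose_GL:
  assumes "A \<in> carrier (GL n)"
  shows "antitranspose n A \<in> carrier (GL n :: 'k :: field mat monoid)"
proof -
  interpret group "GL n :: 'k mat monoid" by (rule group_GL)
  let ?B = "inv\<^bsub>GL n\<^esub> A"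
  have c: "A \<in> carrier_mat n n" "?B \<in> carrier_mat n n" "?B * A = 1\<^sub>m n"
    using assms inv_closed[OF assms] l_inv[OF assms] by (auto simp: carrier_GL)
  have "antitranspose n A * antitranspose n ?B = 1\<^sub>m n"
    unfolding antitranspose_mult[OF c(2,1), symmetric] c(3) by (rule antitranspose_one)
  then have "det (antitranspose n A) * det (antitranspose n ?B) = 1"
    using det_mult[of "antitranspose n A" n "antitranspose n ?B"] by simp
  then show ?thesis by (auto simp: carrier_GL)
qed

lemma antitranspose_unitriangular: "A \<in> unitriangular n \<Longrightarrow> antitranspose n A \<in> unitriangular n"
  by (auto simp: unitriangular_iff antitranspose_index)

lemma eta_antitranspose: "eta n \<psi> (antitranspose n A) = eta n \<psi> A"
proof -
  have "(\<Sum>i<n - 1. antitranspose n A $$ (i, i + 1)) = (\<Sum>i<n - 1. A $$ (i, i + 1))"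
    \<comment> \<open>Position \<open>(i, i + 1)\<close> is reflected to
      \<open>(n - 2 - i, n - 1 - i)\<close>, so the superdiagonal is merely reversed.\<close>
    by (rule sum.reindex_bij_witness[of _ "\<lambda>i. n - 2 - i" "\<lambda>i. n - 2 - i"])
       (auto simp: antitranspose_index numeral_2_eq_2 Suc_diff_Suc)
  then show ?thesis by (simp add: eta_def)
qed

text \<open>\<open>1 + w e\<^sub>j\<^sup>T\<close> and \<open>1 + e\<^sub>i w\<^sup>T\<close>.\<close>

definition col_shear :: "nat \<Rightarrow> nat \<Rightarrow> (nat \<Rightarrow> 'k) \<Rightarrow> 'k :: field mat"
  where "col_shear n j w = mat n n (\<lambda>(a, b). (if a = b then 1 else 0) + (if b = j then w a else 0))"

definition row_shear :: "nat \<Rightarrow> nat \<Rightarrow> (nat \<Rightarrow> 'k) \<Rightarrow> 'k :: field mat"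
  where "row_shear n i w = mat n n (\<lambda>(a, b). (if a = b then 1 else 0) + (if a = i then w b else 0))"

text \<open>From the left the shear is a row operation with source row \<open>j\<close>; its
  counterpart \<open>row_shear_mult\<close> is a column operation with source column
  \<open>i\<close>.\<close>

lemma col_shear_mult:
  assumes "M \<in> carrier_mat n n" "j < n" "a < n" "b < n"
  shows "(col_shear n j w * M) $$ (a, b) = M $$ (a, b) + w a * M $$ (j, b)"
proof -
  have "(col_shear n j w * M) $$ (a, b) =
      (\<Sum>k<n. (if k = a then M $$ (k, b) else 0) + (if k = j then w a * M $$ (k, b) else 0))"
  proof -
    have "(col_shear n j w * M) $$ (a, b) = (\<Sum>k<n. col_shear n j w $$ (a, k) * M $$ (k, b))"
      using assms by (intro mat_mult_index) (simp_all add: col_shear_def)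
    also have "\<dots> = (\<Sum>k<n. (if k = a then M $$ (k, b) else 0) + (if k = j then w a * M $$ (k, b) else 0))"
      by (rule sum.cong) (use assms in \<open>auto simp: col_shear_def distrib_right\<close>)
    finally show ?thesis .
  qed
  then show ?thesis using assms by (simp add: sum.distrib)
qed

lemma row_shear_mult:
  assumes "M \<in> carrier_mat n n" "i < n" "a < n" "b < n"
  shows "(M * row_shear n i w) $$ (a, b) = M $$ (a, b) + M $$ (a, i) * w b"
proof -
  have "(M * row_shear n i w) $$ (a, b) =
      (\<Sum>k<n. (if k = b then M $$ (a, k) else 0) + (if k = i then M $$ (a, k) * w b else 0))"
  proof -
    have "(M * row_shear n i w) $$ (a, b) = (\<Sum>k<n. M $$ (a, k) * row_shear n i w $$ (k, b))"
      using assms by (intro mat_mult_index) (simp_all add: row_shear_def)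
    also have "\<dots> = (\<Sum>k<n. (if k = b then M $$ (a, k) else 0) + (if k = i then M $$ (a, k) * w b else 0))"
      by (rule sum.cong) (use assms in \<open>auto simp: row_shear_def distrib_left\<close>)
    finally show ?thesis .
  qed
  then show ?thesis using assms by (simp add: sum.distrib)
qed

lemma col_shear_unitriangular: "(\<And>a. j \<le> a \<Longrightarrow> a < n \<Longrightarrow> w a = 0) \<Longrightarrow> col_shear n j w \<in> unitriangular n"
  by (auto simp: unitriangular_iff col_shear_def)

lemma row_shear_unitriangular: "(\<And>b. b \<le> i \<Longrightarrow> b < n \<Longrightarrow> w b = 0) \<Longrightarrow> row_shear n i w \<in> unitriangular n"
  by (auto simp: unitriangular_iff row_shear_def)

section \<open>Bruhat decomposition by pivoting\<close>

definition is_pivot :: "nat \<Rightarrow> 'k :: zero mat \<Rightarrow> nat \<Rightarrow> nat \<Rightarrow> bool"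
  where "is_pivot n A r k \<longleftrightarrow> r < n \<and> A $$ (r, k) \<noteq> 0 \<and>
    (\<forall>a<n. a \<noteq> r \<longrightarrow> A $$ (a, k) = 0) \<and> (\<forall>b<n. b \<noteq> k \<longrightarrow> A $$ (r, b) = 0)"

lemma GL_col_nonzero:
  assumes "A \<in> carrier (GL n)" "j < n"
  shows "\<exists>a<n. A $$ (a, j) \<noteq> (0 :: 'k :: field)"
proof (rule ccontr)
  assume *: "\<not> ?thesis"
  interpret group "GL n :: 'k mat monoid" by (rule group_GL)
  let ?B = "inv\<^bsub>GL n\<^esub> A"
  have c: "A \<in> carrier_mat n n" "?B \<in> carrier_mat n n" "?B * A = 1\<^sub>m n"
    using assms inv_closed[OF assms(1)] l_inv[OF assms(1)] by (auto simp: carrier_GL)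
  have "(?B * A) $$ (j, j) = (\<Sum>k<n. ?B $$ (j, k) * A $$ (k, j))"
    by (rule mat_mult_index[OF c(2,1) assms(2,2)])
  also have "\<dots> = 0" using * by (intro sum.neutral) auto
  finally show False using assms(2) unfolding c(3) by simp
qed

text \<open>With the lowest nonzero entry of column \<open>j\<close> as pivot, only entries above it
  and to its right remain to be cleared. Both are done by unitriangular operations that leave the
  earlier pivots intact.\<close>

lemma pivot_step:
  fixes A :: "'k :: field mat"
  assumes A: "A \<in> carrier (GL n)" and j: "j < n"
    and piv: "\<And>k. k < j \<Longrightarrow> \<exists>r. is_pivot n A r k"
  shows "\<exists>u\<in>unitriangular n. \<exists>u'\<in>unitriangular n. \<forall>k\<le>j. \<exists>r. is_pivot n (u * A * u') r k"
proof -
  have Ac: "A \<in> carrier_mat n n" using A by (simp add: carrier_GL)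
  let ?I = "{a. a < n \<and> A $$ (a, j) \<noteq> 0}"
  define i where "i = Max ?I"
  have I: "finite ?I" "?I \<noteq> {}" using GL_col_nonzero[OF A j] by auto
  have "i \<in> ?I" unfolding i_def using I by (rule Max_in)
  then have i: "i < n" "A $$ (i, j) \<noteq> 0" by auto
  have below: "A $$ (a, j) = 0" if "i < a" "a < n" for a
    using Max_ge[OF I(1), of a] that unfolding i_def by fastforce
  define p where "p = A $$ (i, j)"
  have p: "p \<noteq> 0" using i by (simp add: p_def)
  \<comment> \<open>A nonzero entry in an earlier column could only be that column's pivot; row
    \<open>i\<close> would then vanish at \<open>j\<close>.\<close>
  have left: "A $$ (i, b) = 0" if bj: "b < j" for b
  proof (rule ccontr)
    assume nz: "A $$ (i, b) \<noteq> 0"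
    obtain r where r: "is_pivot n A r b" using piv[OF bj] by blast
    then have "i = r" using nz i(1) unfolding is_pivot_def by blast
    then have "A $$ (i, j) = 0" using r bj j unfolding is_pivot_def by blast
    with i(2) show False by simp
  qed
  \<comment> \<open>The multiple of row \<open>i\<close> that clears row \<open>a\<close> in column
    \<open>j\<close>. After this, column \<open>j\<close> has its only nonzero entry in row
    \<open>i\<close>, so the column operation \<open>w'\<close> changes row \<open>i\<close>
    alone.\<close>
  define w where "w a = (if a < i then - A $$ (a, j) / p else 0)" for a
  define w' where "w' b = (if j < b then - A $$ (i, b) / p else 0)" for b
  define u where "u = col_shear n i w"
  define u' where "u' = row_shear n j w'"
  have u: "u \<in> unitriangular n" unfolding u_def by (rule col_shear_unitriangular) (simp add: w_def)
  have u': "u' \<in> unitriangular n" unfolding u'_def by (rule row_shear_unitriangular) (simp add: w'_def)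
  have uA: "u * A \<in> carrier_mat n n" using u Ac by (auto simp: unitriangular_iff)
  define Y where "Y = u * A"
  define h where "h = u * A * u'"
  have Y: "Y $$ (a, b) = A $$ (a, b) + w a * A $$ (i, b)" if "a < n" "b < n" for a b
    unfolding Y_def u_def by (rule col_shear_mult[OF Ac i(1) that])
  have hY: "h $$ (a, b) = Y $$ (a, b) + Y $$ (a, j) * w' b" if "a < n" "b < n" for a b
    unfolding h_def Y_def[symmetric] u'_def
    by (rule row_shear_mult[OF uA[folded Y_def] j that])
  have Yj: "Y $$ (a, j) = (if a = i then p else 0)" if "a < n" for a
    using Y[OF that j] p below[of a] that by (cases a i rule: linorder_cases) (auto simp: w_def p_def[symmetric])
  have h: "h $$ (a, b) = (if a = i then if b = j then p else 0 else A $$ (a, b) + w a * A $$ (i, b))"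
    if "a < n" "b < n" for a b
  proof (cases "a = i")
    case True
    have "h $$ (i, b) = A $$ (i, b) + p * w' b"
      using hY[of i b] Y[of i b] Yj[of i] that True i(1) by (simp add: w_def)
    also have "\<dots> = (if b = j then p else 0)"
      using left[of b] p by (cases b j rule: linorder_cases) (auto simp: w'_def p_def)
    finally show ?thesis using True by simp
  next
    case False
    then show ?thesis using hY[OF that] Y[OF that] Yj[OF that(1)] by simp
  qed
  have "\<exists>r. is_pivot n h r k" if "k \<le> j" for k
  proof (cases "k = j")
    case True
    have "is_pivot n h i j"
      unfolding is_pivot_def
    proof (intro conjI allI impI)
      show "h $$ (a, j) = 0" if "a < n" "a \<noteq> i" for a
        using hY[of a j] Yj[of a] that j by simp
    qed (use h i(1) j p in auto)
    then show ?thesis using True by blast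
  next
    case False
    then have k: "k < j" "k < n" using that j by auto
    obtain r where r: "is_pivot n A r k" using piv[OF k(1)] by blast
    then have r': "r < n" "A $$ (r, k) \<noteq> 0" by (auto simp: is_pivot_def)
    \<comment> \<open>The row of an old pivot vanishes in column \<open>j\<close>: it differs from
      row \<open>i\<close> and the row operation leaves it alone.\<close>
    have "A $$ (r, j) = 0" using r k j unfolding is_pivot_def by blast
    then have "r \<noteq> i" "w r = 0" using i(2) by (auto simp: w_def)
    have "is_pivot n h r k"
      unfolding is_pivot_def
    proof (intro conjI allI impI)
      show "h $$ (r, k) \<noteq> 0" using h[OF r'(1) k(2)] r'(2) \<open>r \<noteq> i\<close> \<open>w r = 0\<close> by simp
      show "h $$ (a, k) = 0" if a: "a < n" "a \<noteq> r" for a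
      proof -
        have "A $$ (a, k) = 0" using r a unfolding is_pivot_def by blast
        then show ?thesis using h[OF a(1) k(2)] left[OF k(1)] k(1) by simp
      qed
      show "h $$ (r, b) = 0" if b: "b < n" "b \<noteq> k" for b
      proof -
        have "A $$ (r, b) = 0" using r b unfolding is_pivot_def by blast
        then show ?thesis using h[OF r'(1) b(1)] \<open>r \<noteq> i\<close> \<open>w r = 0\<close> by simp
      qed
    qed (rule r'(1))
    then show ?thesis by blast
  qed
  then show ?thesis using u u' unfolding h_def by blast
qed

text \<open>A pivot in every column makes the matrix monomial. Columns are treated from left to
  right, and the unitriangular factors accumulate on both sides.\<close>

lemma bruhat_exists:
  fixes A :: "'k :: field mat"
  assumes A: "A \<in> carrier (GL n)"
  shows "\<exists>u\<in>unitriangular n. \<exists>u'\<in>unitriangular n. \<forall>k<n. \<exists>r. is_pivot n (u * A * u') r k"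
proof -
  have "\<exists>u\<in>unitriangular n. \<exists>u'\<in>unitriangular n. \<forall>k<j. \<exists>r. is_pivot n (u * A * u') r k" if "j \<le> n" for j
    using that
  proof (induction j)
    case 0
    show ?case using unitriangular_one by blast
  next
    case (Suc j)
    then obtain u u' where u: "u \<in> unitriangular n" "u' \<in> unitriangular n"
      and piv: "\<forall>k<j. \<exists>r. is_pivot n (u * A * u') r k" by auto
    interpret group "GL n :: 'k mat monoid" by (rule group_GL)
    have G: "u * A * u' \<in> carrier (GL n)"
      using m_closed[OF m_closed[OF unitriangular_GL[OF u(1)] A] unitriangular_GL[OF u(2)]] by simp
    have j: "j < n" using Suc.prems by simp
    obtain v v' where v: "v \<in> unitriangular n" "v' \<in> unitriangular n"
      and piv': "\<forall>k\<le>j. \<exists>r. is_pivot n (v * (u * A * u') * v') r k"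
      using pivot_step[OF G j] piv by blast
    have c: "u \<in> carrier_mat n n" "u' \<in> carrier_mat n n" "v \<in> carrier_mat n n" "v' \<in> carrier_mat n n" "A \<in> carrier_mat n n"
      using u v A by (auto simp: unitriangular_iff carrier_GL)
    have eq: "v * (u * A * u') * v' = (v * u) * A * (u' * v')"
      using c by (simp add: assoc_mult_mat[where n\<^sub>1 = n and n\<^sub>2 = n and n\<^sub>3 = n and n\<^sub>4 = n])
    have "v * u \<in> unitriangular n" "u' * v' \<in> unitriangular n"
      using unitriangular_mult u v by blast+
    then show ?case using piv' unfolding eq less_Suc_eq_le by blast
  qed
  then show ?thesis by blast
qed

section \<open>Invariance under the reflection in the antidiagonal\<close>

text \<open>Applied to a column permutation followed by the reversal of \<open>{..<n}\<close>. Going up from \<open>0\<close>, the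
  values \<open>s k, s k - 1, \<dots>, k\<close> are forced to sit in consecutive places \<open>k, \<dots>, s k\<close>, so \<open>{..<n}\<close> splits
  into blocks that \<open>s\<close> reverses.\<close>

lemma decreasing_runs_involution:
  fixes s :: "nat \<Rightarrow> nat"
  assumes bij: "bij_betw s {..<n} {..<n}"
    and run: "\<And>a b. a < b \<Longrightarrow> b < n \<Longrightarrow> s a = Suc (s b) \<Longrightarrow> b = Suc a"
    and const: "\<And>a. Suc a < n \<Longrightarrow> s a = Suc (s (Suc a)) \<Longrightarrow> c (Suc a) = c a"
    and k: "k < n"
  shows "s (s k) = k \<and> c (s k) = c k"
proof -
  have inj: "s a = s b \<Longrightarrow> a < n \<Longrightarrow> b < n \<Longrightarrow> a = b" for a b
    using bij_betw_imp_inj_on[OF bij] by (auto dest: inj_onD)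
  have lt: "a < n \<Longrightarrow> s a < n" for a
    using bij_betw_imp_surj_on[OF bij] by blast
  have surj: "\<exists>b<n. s b = v" if "v < n" for v
  proof -
    have "v \<in> s ` {..<n}" using bij_betw_imp_surj_on[OF bij] that by simp
    then show ?thesis by blast
  qed
  \<comment> \<open>The initial segment \<open>{..<m}\<close> is a union of complete blocks.\<close>
  let ?P = "\<lambda>m. \<forall>i<m. s i < m \<and> s (s i) = i \<and> c (s i) = c i"
  have step: "\<exists>m'. m < m' \<and> m' \<le> n \<and> ?P m'" if P: "?P m" and m: "m < n" for m
  proof -
    define t where "t = s m"
    have tn: "t < n" unfolding t_def using lt m .
    \<comment> \<open>A value \<open>t < m\<close> is already taken at \<open>s t < m\<close>, where
      \<open>s (s t) = t = s m\<close>, against injectivity.\<close>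
    have tm: "m \<le> t"
    proof (rule ccontr)
      assume "\<not> m \<le> t"
      then have st: "s t < m" "s (s t) = s m" using P by (auto simp: t_def)
      then have "s t = m" using inj[OF st(2)] m by simp
      with st(1) show False by simp
    qed
    have block: "s (m + i) = t - i \<and> c (m + i) = c m \<and> m + i < n" if "i \<le> t - m" for i
      using that
    proof (induction i rule: less_induct)
      case (less i)
      show ?case
      proof (cases i)
        case 0 then show ?thesis using m by (simp add: t_def)
      next
        case (Suc i')
        have IH: "s (m + j) = t - j" "c (m + j) = c m" "m + j < n" if "j \<le> i'" for j
          using less.IH[of j] less.prems that Suc by auto
        \<comment> \<open>The place \<open>b\<close> of the value \<open>t - i\<close> is not before
          \<open>m\<close>, where values are below \<open>m\<close>, nor among the places of the
          block filled so far. So it lies further right, and \<open>run\<close> makes it the next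
          place.\<close>
        have "t - i < n" using tn by simp
        then obtain b where b: "b < n" "s b = t - i" using surj by blast
        have "\<not> b < m"
        proof
          assume "b < m"
          then have "s b < m" using P by blast
          with b(2) less.prems tm show False by simp
        qed
        have ne: "b \<noteq> m + j" if "j \<le> i'" for j
        proof
          assume "b = m + j"
          then have "t - j = t - i" using IH(1)[OF that] b(2) by simp
          then show False using that Suc less.prems tm by simp
        qed
        have gt: "m + i' < b"
          using ne[of "b - m"] \<open>\<not> b < m\<close> by (cases "b - m \<le> i'") auto
        have dec: "s (m + i') = Suc (s b)"
          using IH(1)[of i'] b(2) Suc less.prems tm by simp
        have b': "b = Suc (m + i')" by (rule run[OF gt b(1) dec])
        then have "c b = c m" using const[of "m + i'"] b(1) dec IH(2)[of i'] by simp
        then show ?thesis using b b' Suc by simp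
      qed
    qed
    have "?P (Suc t)"
    proof (intro allI impI)
      fix j assume j: "j < Suc t"
      show "s j < Suc t \<and> s (s j) = j \<and> c (s j) = c j"
      proof (cases "j < m")
        case True
        then have "s j < m" "s (s j) = j" "c (s j) = c j" using P by blast+
          then show ?thesis using tm by simp
      next
        case False
        then have sj: "s j = t - (j - m)" "c j = c m"
          using block[of "j - m"] j by auto
        have "s j = m + (t - j)" using sj(1) j False tm by simp
        moreover have "s (m + (t - j)) = t - (t - j)" "c (m + (t - j)) = c m"
          using block[of "t - j"] False by simp_all
        ultimately show ?thesis using sj(2) j False by simp
      qed
    qed
    then show ?thesis using tm tn by (intro exI[of _ "Suc t"] conjI) simp_all
  qed
  have "?P n" if "?P m" "m \<le> n" for m
    using that
  proof (induction "n - m" arbitrary: m rule: less_induct)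
    case less
    show ?case
    proof (cases "m = n")
      case False
      then have mn: "m < n" using less.prems(2) by simp
      obtain m' where m': "m < m'" "m' \<le> n" "?P m'" using step[OF less.prems(1) mn] by blast
      have "n - m' < n - m" using m'(1) mn by simp
      then show ?thesis using m'(3,2) by (rule less.hyps)
    qed (use less.prems(1) in simp)
  qed
  from this[of 0] have "?P n" by simp
  with k show ?thesis by blast
qed

section \<open>The character of the unitriangular group and the monomial matrices it allows\<close>

lemma nontrivial_character_simps:
  fixes \<psi> :: "'k :: field \<Rightarrow> 'f :: field"
  assumes "nontrivial_character class_ring \<psi>"
  shows nontrivial_character_add: "\<psi> (x + y) = \<psi> x * \<psi> y"
    and nontrivial_character_zero: "\<psi> 0 = 1"
    and nontrivial_character_scale_eq: "(\<And>x. \<psi> (c * x) = 1) \<Longrightarrow> c = 0"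
proof -
  show add: "\<psi> (x + y) = \<psi> x * \<psi> y" for x y
    using assms by (auto simp: nontrivial_character_def hom_def units_of_def)
  have "\<exists>y. y * \<psi> 0 = 1"
    using assms by (auto simp: nontrivial_character_def hom_def units_of_def Units_def Pi_iff)
  then have "\<psi> 0 \<noteq> 0" by auto
  then show "\<psi> 0 = 1" using add[of 0 0] by simp
  obtain x where x: "\<psi> x \<noteq> 1"
    using assms by (auto simp: nontrivial_character_def)
  assume one: "\<And>x. \<psi> (c * x) = 1"
  show "c = 0"
  proof (rule ccontr)
    assume "c \<noteq> 0"
    then have "\<psi> (c * (x / c)) = \<psi> x" by simp
    with one[of "x / c"] x show False by simp
  qed
qed

lemma multiplicative_character_eta:
  fixes \<psi> :: "'k :: {field, finite} \<Rightarrow> 'f :: field"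
  assumes "nontrivial_character class_ring \<psi>"
  shows "multiplicative_character (GL n) (unitriangular n) (eta n \<psi>)"
proof -
  note add = nontrivial_character_add[OF assms] and zero = nontrivial_character_zero[OF assms]
  have "eta n \<psi> (u * w) = eta n \<psi> u * eta n \<psi> w" if "u \<in> unitriangular n" "w \<in> unitriangular n" for u w
  proof -
    have "(\<Sum>i<n - 1. (u * w) $$ (i, i + 1)) = (\<Sum>i<n - 1. u $$ (i, i + 1) + w $$ (i, i + 1))"
      by (rule sum.cong) (use that in \<open>auto simp: unitriangular_mult_index simp del: index_mult_mat\<close>)
    then show ?thesis by (simp only: eta_def sum.distrib add)
  qed
  moreover have "eta n \<psi> (1\<^sub>m n) = 1"
    by (simp add: eta_def zero)
  moreover have "of_nat (card (unitriangular n :: 'k mat set)) \<noteq> (0 :: 'f)"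
    using nontrivial_character_card_nonzero[OF assms] by (simp add: card_unitriangular)
  ultimately show ?thesis
    by (intro multiplicative_character.intro multiplicative_character_axioms.intro group_GL finite_GL subgroup_unitriangular)
       simp_all
qed

text \<open>With a single weight the shear is the elementary matrix \<open>1 + x E_ab\<close>, which
  \<open>eta\<close> detects only on the superdiagonal.\<close>

lemma eta_col_shear:
  assumes "a < b" "b < n"
  shows "eta n \<psi> (col_shear n b (\<lambda>i. if i = a then x else 0)) = \<psi> (if b = Suc a then x else (0 :: 'k :: field))"
proof -
  have "(\<Sum>i<n - 1. col_shear n b (\<lambda>i. if i = a then x else 0) $$ (i, i + 1)) =
      (\<Sum>i<n - 1. if i = a then if b = Suc a then x else 0 else 0)"
    by (rule sum.cong) (auto simp: col_shear_def)
  also have "\<dots> = (if b = Suc a then x else 0)"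
    by (cases "b = Suc a") (use assms in auto)
  finally show ?thesis by (simp add: eta_def)
qed

lemma col_shear_eq_row_shear:
  "col_shear n b (\<lambda>i. if i = a then x else 0) = row_shear n a (\<lambda>i. if i = b then x else 0)"
  by (intro eq_matI) (auto simp: col_shear_def row_shear_def)

text \<open>Moving \<open>1 + x E_ab\<close> through the monomial matrix \<open>M\<close> gives an
  elementary matrix at \<open>(\<sigma> a, \<sigma> b)\<close>. If both are unitriangular and
  \<open>f M\<close> is nonzero, \<open>eta\<close> must agree on them; this yields the hypotheses
  of \<open>decreasing_runs_involution\<close>.\<close>

lemma antitranspose_pivots_eq:
  fixes M :: "'k :: {field, finite} mat" and f :: "'k mat \<Rightarrow> 'f :: field"
  assumes \<psi>: "nontrivial_character class_ring \<psi>"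
    and hecke: "multiplicative_character.hecke (GL n) (unitriangular n) (eta n \<psi>) f"
    and M: "M \<in> carrier (GL n)" and piv: "\<And>k. k < n \<Longrightarrow> \<exists>r. is_pivot n M r k" and nz: "f M \<noteq> 0"
  shows "antitranspose n M = M"
proof -
  interpret multiplicative_character "GL n :: 'k mat monoid" "unitriangular n" "eta n \<psi>"
    by (rule multiplicative_character_eta[OF \<psi>])
  note add = nontrivial_character_add[OF \<psi>] and zero = nontrivial_character_zero[OF \<psi>]
  have Mc: "M \<in> carrier_mat n n" using M by (simp add: carrier_GL)
  obtain \<sigma> where \<sigma>: "\<And>k. k < n \<Longrightarrow> is_pivot n M (\<sigma> k) k" using piv by metis
  define c where "c k = M $$ (\<sigma> k, k)" for k
  have \<sigma>_lt: "\<sigma> k < n" and c_nz: "c k \<noteq> 0" if "k < n" for k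
    using \<sigma>[OF that] by (auto simp: is_pivot_def c_def)
  have M_index: "M $$ (a, k) = (if a = \<sigma> k then c k else 0)" if "a < n" "k < n" for a k
    using \<sigma>[OF that(2)] that(1) by (auto simp: is_pivot_def c_def)
  have inj: "k = k'" if "\<sigma> k = \<sigma> k'" "k < n" "k' < n" for k k'
  proof (rule ccontr)
    assume "k \<noteq> k'"
    then have "M $$ (\<sigma> k', k) = 0" using \<sigma>[OF that(3)] that(2) unfolding is_pivot_def by blast
    with c_nz[OF that(2)] that(1) show False by (simp add: c_def)
  qed
  have bij: "bij_betw \<sigma> {..<n} {..<n}"
  proof -
    have inj': "inj_on \<sigma> {..<n}" by (rule inj_onI) (use inj in simp)
    have "\<sigma> ` {..<n} = {..<n}"
      by (rule endo_inj_surj[OF finite_lessThan _ inj']) (use \<sigma>_lt in auto)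
    with inj' show ?thesis by (rule bij_betw_imageI)
  qed
  have cond: "\<psi> (if \<sigma> b = Suc (\<sigma> a) then c a / c b * x else 0) = \<psi> (if b = Suc a then x else 0)"
    if ab: "a < b" "b < n" and s: "\<sigma> a < \<sigma> b" for a b x
  proof -
    have an: "a < n" using ab by simp
    let ?u = "col_shear n b (\<lambda>i. if i = a then x else 0)"
    \<comment> \<open>The weight balances the entries of \<open>M\<close>: at
      \<open>(\<sigma> a, b)\<close> the left product adds weight times \<open>c b\<close>, the
      right one \<open>c a * x\<close>.\<close>
    let ?u' = "col_shear n (\<sigma> b) (\<lambda>i. if i = \<sigma> a then c a / c b * x else 0)"
    have u: "?u \<in> unitriangular n" by (rule col_shear_unitriangular) (use ab in auto)
    have u': "?u' \<in> unitriangular n" by (rule col_shear_unitriangular) (use s in auto)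
    have "?u' * M = M * ?u"
    proof (rule eq_matI)
      fix i j assume "i < dim_row (M * ?u)" "j < dim_col (M * ?u)"
      then have ij: "i < n" "j < n" using Mc by (auto simp: col_shear_def)
      have R: "(M * ?u) $$ (i, j) = M $$ (i, j) + M $$ (i, a) * (if j = b then x else 0)"
        unfolding col_shear_eq_row_shear by (rule row_shear_mult[OF Mc an ij])
      have L: "(?u' * M) $$ (i, j) = M $$ (i, j) + (if i = \<sigma> a then c a / c b * x else 0) * M $$ (\<sigma> b, j)"
        by (rule col_shear_mult[OF Mc \<sigma>_lt[OF ab(2)] ij])
      have Mb: "M $$ (\<sigma> b, j) = (if j = b then c b else 0)"
        unfolding M_index[OF \<sigma>_lt[OF ab(2)] ij(2)] using inj[OF _ ab(2) ij(2)] by auto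
      have Ma: "M $$ (i, a) = (if i = \<sigma> a then c a else 0)"
        by (rule M_index[OF ij(1) an])
      show "(?u' * M) $$ (i, j) = (M * ?u) $$ (i, j)"
        unfolding L R Mb Ma using c_nz[OF ab(2)] by simp
    qed (use Mc in \<open>auto simp: col_shear_def\<close>)
    then have "f (?u' * M) = f (M * ?u)" by (rule arg_cong)
    moreover have "f (?u' * M) = eta n \<psi> (inv\<^bsub>GL n\<^esub> ?u') * f M" "f (M * ?u) = eta n \<psi> (inv\<^bsub>GL n\<^esub> ?u) * f M"
      using hecke_left[OF hecke u' M] hecke_right[OF hecke u M] unfolding GL_mult .
    ultimately have "eta n \<psi> (inv\<^bsub>GL n\<^esub> ?u') = eta n \<psi> (inv\<^bsub>GL n\<^esub> ?u)"
      using mult_right_cancel[OF nz] by (simp only:)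
    then have "eta n \<psi> ?u' = eta n \<psi> ?u"
      unfolding theta_inv_eq[OF u] theta_inv_eq[OF u'] by (rule inverse_eq_imp_eq)
    then show ?thesis
      unfolding eta_col_shear[OF s \<sigma>_lt[OF ab(2)]] eta_col_shear[OF ab] .
  qed
  \<comment> \<open>The reversal turns ascents \<open>\<sigma> b = \<sigma> a + 1\<close> into the
    descents by one of the combinatorial lemma.\<close>
  define s where "s k = n - 1 - \<sigma> k" for k
  have s_bij: "bij_betw s {..<n} {..<n}"
  proof -
    have "bij_betw (\<lambda>k. n - 1 - k) {..<n} {..<n}"
      by (rule bij_betwI[where g = "\<lambda>k. n - 1 - k"]) auto
    from bij_betw_trans[OF bij this] show ?thesis by (simp add: s_def[abs_def] o_def)
  qed
  have Suc_s: "\<sigma> b = Suc (\<sigma> a)" if "s a = Suc (s b)" "a < n" "b < n" for a b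
    using that \<sigma>_lt[of a] \<sigma>_lt[of b] by (auto simp: s_def)
  \<comment> \<open>Otherwise only the left elementary matrix lies on the superdiagonal, and
    \<open>\<psi>\<close> would be trivial on all multiples of the nonzero
    \<open>c a / c b\<close>.\<close>
  have run: "b = Suc a" if ab: "a < b" "b < n" and s: "s a = Suc (s b)" for a b
  proof (rule ccontr)
    assume ne: "b \<noteq> Suc a"
    have sb: "\<sigma> b = Suc (\<sigma> a)" using Suc_s[OF s] ab by simp
    have "\<psi> (c a / c b * x) = 1" for x
    proof -
      have "\<sigma> a < \<sigma> b" using sb by simp
      from cond[OF ab this, of x] show ?thesis unfolding if_P[OF sb] if_not_P[OF ne] zero .
    qed
    then have "c a / c b = 0" by (rule nontrivial_character_scale_eq[OF \<psi>])
    then show False using c_nz[of a] c_nz[of b] ab by simp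
  qed
  \<comment> \<open>Both elementary matrices lie on the superdiagonal, so
    \<open>\<psi> (r * x) = \<psi> x\<close> for all \<open>x\<close>, where
    \<open>r = c a / c (Suc a)\<close>. Nontriviality applied to the scale \<open>r - 1\<close>
    gives \<open>r = 1\<close>.\<close>
  have const: "c (Suc a) = c a" if a: "Suc a < n" and s: "s a = Suc (s (Suc a))" for a
  proof -
    have sb: "\<sigma> (Suc a) = Suc (\<sigma> a)" using Suc_s[OF s] a by simp
    have eq: "\<psi> (c a / c (Suc a) * x) = \<psi> x" for x
    proof -
      have "\<sigma> a < \<sigma> (Suc a)" using sb by simp
      from cond[OF lessI a this, of x] show ?thesis unfolding if_P[OF sb] if_P[OF refl] .
    qed
    have "\<psi> ((c a / c (Suc a) - 1) * x) = 1" for x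
    proof -
      have "(c a / c (Suc a) - 1) * x = c a / c (Suc a) * x + - x" by (simp add: left_diff_distrib)
      then have "\<psi> ((c a / c (Suc a) - 1) * x) = \<psi> x * \<psi> (- x)" by (simp only: add eq)
      also have "\<dots> = 1" using add[of x "- x"] zero by simp
      finally show ?thesis .
    qed
    then have "c a / c (Suc a) - 1 = 0" by (rule nontrivial_character_scale_eq[OF \<psi>])
    then have "c a / c (Suc a) = 1" by simp
    then show ?thesis using c_nz[OF a] by simp
  qed
  have invol: "s (s k) = k \<and> c (s k) = c k" if "k < n" for k
    by (rule decreasing_runs_involution[OF s_bij _ _ that]) (erule (2) run, erule (1) const)
  show ?thesis
  proof (rule eq_matI)
    fix i j assume "i < dim_row M" "j < dim_col M"
    then have ij: "i < n" "j < n" using Mc by auto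
    have i': "n - 1 - i < n" and j': "n - 1 - j < n" using ij by auto
    \<comment> \<open>The reflected matrix is nonzero at \<open>(i, j)\<close> iff
      \<open>s (n - 1 - i) = j\<close>, and \<open>M\<close> iff \<open>s j = n - 1 - i\<close>; the
      two agree because \<open>s\<close> is an involution.\<close>
    have "n - 1 - j = \<sigma> (n - 1 - i) \<longleftrightarrow> s (n - 1 - i) = j"
      using \<sigma>_lt[OF i'] ij unfolding s_def by arith
    also have "\<dots> \<longleftrightarrow> s j = n - 1 - i"
    proof
      assume "s (n - 1 - i) = j"
      from arg_cong[OF this, of s] show "s j = n - 1 - i" unfolding conjunct1[OF invol[OF i']] by (rule sym)
    next
      assume "s j = n - 1 - i"
      from arg_cong[OF this, of s] show "s (n - 1 - i) = j" unfolding conjunct1[OF invol[OF ij(2)]] by (rule sym)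
    qed
    also have "\<dots> \<longleftrightarrow> i = \<sigma> j"
      using \<sigma>_lt[OF ij(2)] ij unfolding s_def by arith
    finally have iff: "n - 1 - j = \<sigma> (n - 1 - i) \<longleftrightarrow> i = \<sigma> j" .
    have "c (n - 1 - i) = c j" if "i = \<sigma> j"
      using conjunct2[OF invol[OF ij(2)]] that by (simp add: s_def)
    then show "antitranspose n M $$ (i, j) = M $$ (i, j)"
      unfolding antitranspose_index[OF ij] M_index[OF j' i'] M_index[OF ij] iff by simp
  qed (use Mc in \<open>auto simp: antitranspose_def\<close>)
qed

text \<open>Both \<open>f\<close> and its reflection are Hecke functions, so each is determined on a
  double coset by its value at a monomial representative, where the two values can be
  compared.\<close>

lemma hecke_antitranspose:
  fixes A :: "'k :: {field, finite} mat" and f :: "'k mat \<Rightarrow> 'f :: field"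
  assumes \<psi>: "nontrivial_character class_ring \<psi>"
    and f: "multiplicative_character.hecke (GL n) (unitriangular n) (eta n \<psi>) f"
    and A: "A \<in> carrier (GL n)"
  shows "f (antitranspose n A) = f A"
proof -
  interpret multiplicative_character "GL n :: 'k mat monoid" "unitriangular n" "eta n \<psi>"
    by (rule multiplicative_character_eta[OF \<psi>])
  let ?t = "antitranspose n :: 'k mat \<Rightarrow> 'k mat"
  have mult: "?t (x * y) = ?t y * ?t x" if "x \<in> carrier (GL n)" "y \<in> carrier (GL n)" for x y
    using that by (intro antitranspose_mult) (auto simp: carrier_GL)
  have inv_eta: "eta n \<psi> (inv\<^bsub>GL n\<^esub> (?t u)) = eta n \<psi> (inv\<^bsub>GL n\<^esub> u)" if u: "u \<in> unitriangular n" for u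
    unfolding theta_inv_eq[OF u] theta_inv_eq[OF antitranspose_unitriangular[OF u]] eta_antitranspose ..
  have f_left: "f (u * x) = eta n \<psi> (inv\<^bsub>GL n\<^esub> u) * f x" and f_right: "f (x * u) = eta n \<psi> (inv\<^bsub>GL n\<^esub> u) * f x"
    if "u \<in> unitriangular n" "x \<in> carrier (GL n)" for u x
    using hecke_left[OF f that] hecke_right[OF f that] unfolding GL_mult .
  have t_left: "f (?t (u * x)) = eta n \<psi> (inv\<^bsub>GL n\<^esub> u) * f (?t x)"
    and t_right: "f (?t (x * u)) = eta n \<psi> (inv\<^bsub>GL n\<^esub> u) * f (?t x)"
    if u: "u \<in> unitriangular n" and x: "x \<in> carrier (GL n)" for u x
    unfolding mult[OF unitriangular_GL[OF u] x] mult[OF x unitriangular_GL[OF u]]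
      f_right[OF antitranspose_unitriangular[OF u] antitranspose_GL[OF x]]
      f_left[OF antitranspose_unitriangular[OF u] antitranspose_GL[OF x]] inv_eta[OF u]
    by (rule refl)+
  have ft: "hecke (\<lambda>x. f (?t x))"
    unfolding hecke_def GL_mult by (intro ballI conjI t_left t_right)
  obtain u u' where u: "u \<in> unitriangular n" "u' \<in> unitriangular n"
    and piv: "\<forall>k<n. \<exists>r. is_pivot n (u * A * u') r k"
    using bruhat_exists[OF A] by blast
  define M where "M = u * A * u'"
  have uA: "u * A \<in> carrier (GL n)" using m_closed[OF unitriangular_GL[OF u(1)] A] by simp
  then have M: "M \<in> carrier (GL n)" using m_closed[OF uA unitriangular_GL[OF u(2)]] by (simp add: M_def)
  have "f (?t M) = f M"
  \<comment> \<open>If \<open>f M\<close> vanishes but \<open>f (?t M)\<close> does not, the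
    preceding lemma is applied to the reflected function, which is Hecke by
    \<open>ft\<close>.\<close>
  proof (cases "f M = 0 \<and> f (?t M) = 0")
    case False
    then have "?t M = M"
      using antitranspose_pivots_eq[OF \<psi> f M] antitranspose_pivots_eq[OF \<psi> ft M] piv[folded M_def] by blast
    then show ?thesis by simp
  qed simp
  \<comment> \<open>Passing from \<open>M\<close> back to \<open>A\<close> produces the same factors
    on both sides, since reflection preserves \<open>eta\<close>; they are invertible and
    cancel.\<close>
  then have "eta n \<psi> (inv\<^bsub>GL n\<^esub> u') * (eta n \<psi> (inv\<^bsub>GL n\<^esub> u) * f (?t A)) =
     eta n \<psi> (inv\<^bsub>GL n\<^esub> u') * (eta n \<psi> (inv\<^bsub>GL n\<^esub> u) * f A)"
    unfolding M_def t_left[OF u(1) A] t_right[OF u(2) uA] f_left[OF u(1) A] f_right[OF u(2) uA] .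
  moreover have "eta n \<psi> (inv\<^bsub>GL n\<^esub> v) \<noteq> 0" if "v \<in> unitriangular n" for v
    using theta_inv(1)[OF that] by auto
  ultimately show ?thesis using u by simp
qed

theorem corollary5p2:
  fixes \<psi> :: "'k :: {field, finite} \<Rightarrow> 'l :: prime_card mod_ring alg_closure"
    and n :: nat
  assumes "n \<ge> 2"
    and "nontrivial_character (Fl_bar TYPE('l)) \<psi>"
  shows "multiplicity_free_triple TYPE('v) (Fl_bar TYPE('l)) (GL n) (unitriangular n)
    (line (Fl_bar TYPE('l))) (character_action (Fl_bar TYPE('l)) (eta n \<psi>))"
proof -
  note \<psi> = assms(2)
  interpret multiplicative_character "GL n :: 'k mat monoid" "unitriangular n" "eta n \<psi>"
    by (rule multiplicative_character_eta[OF \<psi>])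
  have comm: "conv f h x = conv h f x" if "hecke f" "hecke h" "x \<in> carrier (GL n)" for f h x
  proof (rule conv_commute_if_anti_involution[OF _ _ _ _ that])
    show "antitranspose n x \<in> carrier (GL n)" if "x \<in> carrier (GL n)" for x :: "'k mat"
      using that by (rule antitranspose_GL)
    show "antitranspose n (antitranspose n x) = x" if "x \<in> carrier (GL n)" for x :: "'k mat"
      using that by (intro antitranspose_antitranspose) (simp add: carrier_GL)
    show "antitranspose n (x \<otimes>\<^bsub>GL n\<^esub> y) = antitranspose n y \<otimes>\<^bsub>GL n\<^esub> antitranspose n x"
      if "x \<in> carrier (GL n)" "y \<in> carrier (GL n)" for x y :: "'k mat"
      using that unfolding GL_mult by (intro antitranspose_mult) (simp_all add: carrier_GL)
    show "f (antitranspose n x) = f x" if "hecke f" "x \<in> carrier (GL n)" for f x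
      using that by (rule hecke_antitranspose[OF \<psi>])
  qed
  have "vectorspace.fin_dim class_ring (rep_Hom (GL n) class_ring V \<pi> Ind ind_act) \<and>
      vectorspace.dim class_ring (rep_Hom (GL n) class_ring V \<pi> Ind ind_act) \<le> 1"
    if "irreducible_representation (GL n) class_ring V \<pi>" for V :: "('l mod_ring alg_closure, 'v) module" and \<pi>
  proof -
    interpret irreducible_with_character "GL n :: 'k mat monoid" "unitriangular n" "eta n \<psi>" V \<pi>
      by (intro irreducible_with_character.intro irreducible_with_character_axioms.intro multiplicative_character_axioms that)
    show ?thesis by (rule rep_Hom_Ind_dim_le_1[OF comm])
  qed
  then show ?thesis
    unfolding multiplicity_free_triple_def Let_def
    using is_group finite_G subgroup_U group_representation_line by blast
qed

end
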